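(* Let $H$ be an infinite dimensional complex Hilbert space and let $A, B \in \mathscr{L}(H)$ be such that $A$ and $B^*$ are hyponormal. Then the generalised derivation $\tau_{A,B} \colon C_2 \to C_2$, $\tau_{A,B}(T) = AT - TB$, is not supercyclic, where $C_2$ is the space of Hilbert–Schmidt operators on $H$.
   Context: $\mathscr{L}(H)$ is the space of bounded linear operators on $H$. An operator $T \in \mathscr{L}(H)$ is hyponormal if $T^*T - TT^* \ge 0$, equivalently $\lVert Tx\rVert \ge \lVert T^*x\rVert$ for all $x \in H$. $C_2$ is equipped with the Hilbert–Schmidt norm $\lVert T\rVert_2^2 = \mathrm{tr}(T^*T) = \sum_j \lVert Te_j\rVert^2$ for any orthonormal basis $(e_j)$ of $H$. An operator $U$ on a Banach space $Y$ is supercyclic if there is $y \in Y$ such that $\{\lambda U^n y : n \ge 0,\ \lambda \in \mathbb{C}\}$ is dense in $Y$. *)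

theory Defs
  imports "HOL-Analysis.Analysis"
begin

section \<open>Complex normed spaces and Hilbert spaces\<close>

class complex_normed_vector = real_normed_vector +
  fixes scaleC :: "complex \<Rightarrow> 'a \<Rightarrow> 'a"  (infixr "*\<^sub>C" 75)
  assumes scaleC_add_right: "a *\<^sub>C (x + y) = a *\<^sub>C x + a *\<^sub>C y"
    and scaleC_add_left: "(a + b) *\<^sub>C x = a *\<^sub>C x + b *\<^sub>C x"
    and scaleC_scaleC: "a *\<^sub>C b *\<^sub>C x = (a * b) *\<^sub>C x"
    and scaleR_scaleC: "r *\<^sub>R x = complex_of_real r *\<^sub>C x"
    and norm_scaleC: "norm (a *\<^sub>C x) = cmod a * norm x"

class complex_banach = complex_normed_vector + banach

text \<open>The inner product is linear in the first and conjugate-linear in the second argument.\<close>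

class complex_hilbert = complex_banach +
  fixes cinner :: "'a \<Rightarrow> 'a \<Rightarrow> complex"
  assumes cinner_commute: "cinner x y = cnj (cinner y x)"
    and cinner_add_left: "cinner (x + y) z = cinner x z + cinner y z"
    and cinner_scaleC_left: "cinner (a *\<^sub>C x) y = a * cinner x y"
    and cinner_self: "cinner x x = complex_of_real ((norm x)\<^sup>2)"

lemma scaleC_one: "1 *\<^sub>C x = x"
  using scaleR_scaleC[of 1 x] by simp

global_interpretation cvec: vector_space "scaleC :: complex \<Rightarrow> 'a \<Rightarrow> 'a::complex_normed_vector"
  by standard (simp_all add: scaleC_add_right scaleC_add_left scaleC_scaleC scaleC_one)

abbreviation cspan :: "'a::complex_normed_vector set \<Rightarrow> 'a set"
  where "cspan \<equiv> module.span scaleC"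

lemma bounded_linear_scaleC: "bounded_linear (\<lambda>x::'a::complex_normed_vector. c *\<^sub>C x)"
  by (rule bounded_linear_intro[where K = "cmod c"])
    (simp_all add: scaleC_add_right scaleR_scaleC scaleC_scaleC norm_scaleC mult.commute)

lemmas tendsto_scaleC = bounded_linear.tendsto[OF bounded_linear_scaleC]

definition bounded_clinear :: "('a::complex_normed_vector \<Rightarrow> 'b::complex_normed_vector) \<Rightarrow> bool"
  where "bounded_clinear T \<longleftrightarrow> bounded_linear T \<and> (\<forall>c x. T (c *\<^sub>C x) = c *\<^sub>C T x)"

text \<open>Boundedness and linearity of \<open>U\<close> are not part of the definition.\<close>

definition supercyclic :: "('a::complex_banach \<Rightarrow> 'a) \<Rightarrow> bool"
  where "supercyclic U \<longleftrightarrow> (\<exists>y. closure {c *\<^sub>C (U ^^ n) y | c n. True} = UNIV)"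

definition cadjoint :: "('a::complex_hilbert \<Rightarrow> 'a) \<Rightarrow> 'a \<Rightarrow> 'a"
  where "cadjoint T = (THE S. \<forall>x y. cinner (T x) y = cinner x (S y))"

definition positive_op :: "('a::complex_hilbert \<Rightarrow> 'a) \<Rightarrow> bool"
  where "positive_op S \<longleftrightarrow> (\<forall>x. cinner (S x) x \<in> \<real>\<^sub>\<ge>\<^sub>0)"

definition hyponormal :: "('a::complex_hilbert \<Rightarrow> 'a) \<Rightarrow> bool"
  where "hyponormal T \<longleftrightarrow> positive_op (\<lambda>x. cadjoint T (T x) - T (cadjoint T x))"

definition is_orthonormal :: "'a::complex_hilbert set \<Rightarrow> bool"
  where "is_orthonormal E \<longleftrightarrow>
    (\<forall>e\<in>E. norm e = 1) \<and> (\<forall>e\<in>E. \<forall>f\<in>E. e \<noteq> f \<longrightarrow> cinner e f = 0)"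

definition is_onb :: "'a::complex_hilbert set \<Rightarrow> bool"
  where "is_onb E \<longleftrightarrow> is_orthonormal E \<and> closure (cspan E) = UNIV"

definition is_hilbert_schmidt :: "('a::complex_hilbert \<Rightarrow> 'a) \<Rightarrow> bool"
  where "is_hilbert_schmidt T \<longleftrightarrow> bounded_clinear T \<and>
    (\<exists>E. is_onb E \<and> (\<lambda>e. (norm (T e))\<^sup>2) summable_on E)"

text \<open>An orthonormal basis exists (\<open>onb_exists\<close>), and the norm does not depend
  on the chosen one (\<open>hs_norm_has_sum\<close>).\<close>

definition hs_norm :: "('a::complex_hilbert \<Rightarrow> 'a) \<Rightarrow> real"
  where "hs_norm T = sqrt (\<Sum>\<^sub>\<infinity>e\<in>(SOME E. is_onb E). (norm (T e))\<^sup>2)"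


section \<open>Basic Hilbert space theory\<close>

lemma bounded_clinear_add: "bounded_clinear T \<Longrightarrow> T (x + y) = T x + T y"
  by (simp add: bounded_clinear_def linear_simps)

lemma bounded_clinear_diff: "bounded_clinear T \<Longrightarrow> T (x - y) = T x - T y"
  by (simp add: bounded_clinear_def linear_simps)

lemma bounded_clinear_scaleC: "bounded_clinear T \<Longrightarrow> T (c *\<^sub>C x) = c *\<^sub>C T x"
  by (simp add: bounded_clinear_def)

lemma bounded_clinear_bound:
  assumes "bounded_clinear T"
  obtains K where "K \<ge> 0" "\<And>x. norm (T x) \<le> K * norm x"
  using assms bounded_linear.nonneg_bounded[of T]
  by (auto simp: bounded_clinear_def mult.commute)

lemma bounded_clinearI:
  assumes "\<And>x y. T (x + y) = T x + T y" "\<And>c x. T (c *\<^sub>C x) = c *\<^sub>C T x"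
    and "\<And>x. norm (T x) \<le> K * norm x"
  shows "bounded_clinear T"
  unfolding bounded_clinear_def
  by (auto intro!: bounded_linear_intro[where K = K] simp: assms scaleR_scaleC mult.commute[of _ K])

lemma bounded_clinear_compose:
  "bounded_clinear S \<Longrightarrow> bounded_clinear T \<Longrightarrow> bounded_clinear (\<lambda>x. S (T x))"
  by (simp add: bounded_clinear_def bounded_linear_compose)

lemma cinner_add_right: "cinner x (y + z) = cinner x y + cinner x z"
  by (metis cinner_add_left cinner_commute complex_cnj_add)

lemma cinner_scaleC_right: "cinner x (a *\<^sub>C y) = cnj a * cinner x y"
  by (metis cinner_commute cinner_scaleC_left complex_cnj_mult)

lemma cinner_zero_left [simp]: "cinner 0 x = 0"
  using cinner_add_left[of 0 0 x] by simp

lemma cinner_zero_right [simp]: "cinner x 0 = 0"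
  using cinner_add_right[of x 0 0] by simp

lemma cinner_diff_left: "cinner (x - y) z = cinner x z - cinner y z"
  using cinner_add_left[of "x - y" y z] by simp

lemma cinner_diff_right: "cinner z (x - y) = cinner z x - cinner z y"
  using cinner_add_right[of z "x - y" y] by simp

lemma norm_sq_cinner: "(norm x)\<^sup>2 = Re (cinner x x)"
  by (simp add: cinner_self)

lemma norm_diff_sq:
  "(norm (x - y))\<^sup>2 = (norm x)\<^sup>2 - 2 * Re (cinner x y) + (norm y)\<^sup>2"
  using cinner_commute[of y x]
  by (simp add: norm_sq_cinner cinner_diff_left cinner_diff_right)

lemma parallelogram: "(norm (x + y))\<^sup>2 + (norm (x - y))\<^sup>2 = 2 * (norm x)\<^sup>2 + 2 * (norm y)\<^sup>2"
  for x y :: "'a::complex_hilbert"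
  by (simp add: norm_sq_cinner cinner_diff_left cinner_diff_right cinner_add_left cinner_add_right)

lemma norm_diff_scaleC_sq:
  assumes "y \<noteq> 0"
  shows "(norm (x - (cinner x y / complex_of_real ((norm y)\<^sup>2)) *\<^sub>C y))\<^sup>2
    = (norm x)\<^sup>2 - (cmod (cinner x y))\<^sup>2 / (norm y)\<^sup>2"
proof -
  define a where "a = cinner x y"
  define s where "s = (norm y)\<^sup>2"
  have s: "s > 0" using assms by (simp add: s_def)
  have 1: "Re (cnj (a / complex_of_real s) * a) = (cmod a)\<^sup>2 / s"
    by (metis (no_types, lifting) Re_complex_of_real complex_cnj_complex_of_real
        complex_cnj_divide complex_norm_square mult.commute of_real_divide times_divide_eq_left)
  have 2: "(norm ((a / complex_of_real s) *\<^sub>C y))\<^sup>2 = (cmod a)\<^sup>2 / s"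
    using s by (simp add: norm_scaleC norm_divide power_mult_distrib power_divide
        flip: s_def) (simp add: power2_eq_square)
  show ?thesis
    using 1 2 unfolding norm_diff_sq cinner_scaleC_right a_def[symmetric] s_def[symmetric]
    by linarith
qed

lemma Cauchy_Schwarz: "cmod (cinner x y) \<le> norm x * norm y"
proof (cases "y = 0")
  case False
  then have "(cmod (cinner x y))\<^sup>2 \<le> (norm x)\<^sup>2 * (norm y)\<^sup>2"
    using norm_diff_scaleC_sq[OF False, of x] zero_le_power2[of "norm _"]
    by (metis diff_ge_0_iff_ge divide_le_eq norm_eq_zero zero_less_norm_iff zero_less_power)
  then show ?thesis
    by (metis norm_ge_zero mult_nonneg_nonneg power2_le_imp_le power_mult_distrib)
qed simp

lemma projection_exists:
  fixes M :: "'a::complex_hilbert set"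
  assumes cl: "closed M" and sub: "cvec.subspace M"
  obtains p where "p \<in> M" "\<And>m. m \<in> M \<Longrightarrow> cinner (x - p) m = 0"
proof -
  define d where "d = infdist x M"
  have 0: "0 \<in> M" and ne: "M \<noteq> {}" using sub cvec.subspace_0 by auto
  have d0: "d \<ge> 0" by (simp add: d_def infdist_nonneg)
  have d: "d \<le> norm (x - m)" if "m \<in> M" for m
    using infdist_le[OF that, of x] by (simp add: d_def dist_norm)
  have d2: "d\<^sup>2 \<le> (norm (x - m))\<^sup>2" if "m \<in> M" for m
    using d[OF that] d0 by (simp add: power_mono)
  have ex: "\<exists>m\<in>M. (norm (x - m))\<^sup>2 < d\<^sup>2 + e" if "e > 0" for e
  proof -
    have "d < sqrt (d\<^sup>2 + e)"
      using that by (simp add: d0 real_less_rsqrt)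
    then obtain m where "m \<in> M" "norm (x - m) < sqrt (d\<^sup>2 + e)"
      using cInf_lessD[of "dist x ` M" "sqrt (d\<^sup>2 + e)"] ne
      by (auto simp: d_def infdist_def dist_norm)
    then show ?thesis
      using that real_less_rsqrt[of "norm (x - m)"]
      by (metis add_nonneg_nonneg less_eq_real_def norm_ge_zero
          real_sqrt_less_iff real_sqrt_unique zero_le_power2)
  qed
  have "\<forall>n. \<exists>m\<in>M. (norm (x - m))\<^sup>2 < d\<^sup>2 + inverse (real (Suc n))"
    using ex by simp
  then obtain m where mM: "\<And>n. m n \<in> M"
    and m: "\<And>n. (norm (x - m n))\<^sup>2 < d\<^sup>2 + inverse (real (Suc n))"
    by metis
  have close: "(norm (m k - m n))\<^sup>2 < 2 * inverse (real (Suc n)) + 2 * inverse (real (Suc k))" for n k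
  proof -
    have "(1/2) *\<^sub>R (m n + m k) \<in> M"
      by (simp add: scaleR_scaleC cvec.subspace_scale[OF sub] cvec.subspace_add[OF sub] mM)
    then have "d\<^sup>2 \<le> (norm (x - (1/2) *\<^sub>R (m n + m k)))\<^sup>2" by (rule d2)
    moreover have "(x - m n) + (x - m k) = 2 *\<^sub>R (x - (1/2) *\<^sub>R (m n + m k))"
      by (simp add: algebra_simps scaleR_2)
    then have "(norm ((x - m n) + (x - m k)))\<^sup>2 = 4 * (norm (x - (1/2) *\<^sub>R (m n + m k)))\<^sup>2"
      by (simp add: power_mult_distrib)
    ultimately show ?thesis
      using parallelogram[of "x - m n" "x - m k"] m[of n] m[of k] by simp
  qed
  have "Cauchy m"
  proof (rule metric_CauchyI)
    fix e :: real assume "e > 0"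
    then obtain N where N: "inverse (real (Suc N)) < e\<^sup>2 / 4"
      using reals_Archimedean[of "e\<^sup>2 / 4"] by auto
    have "dist (m k) (m n) < e" if "k \<ge> N" "n \<ge> N" for k n
    proof -
      have "inverse (real (Suc k)) \<le> inverse (real (Suc N))"
        "inverse (real (Suc n)) \<le> inverse (real (Suc N))"
        using that by (auto intro!: le_imp_inverse_le)
      then have "(norm (m k - m n))\<^sup>2 < e\<^sup>2"
        using close[of k n] N by linarith
      then show ?thesis
        using \<open>e > 0\<close> by (simp add: dist_norm power_less_imp_less_base)
    qed
    then show "\<exists>N. \<forall>k\<ge>N. \<forall>n\<ge>N. dist (m k) (m n) < e" by blast
  qed
  then obtain p where p: "m \<longlonglongrightarrow> p" using Cauchy_convergent convergent_def by blast
  have pM: "p \<in> M" using closed_sequentially[OF cl] mM p by blast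
  have "(\<lambda>n. (norm (x - m n))\<^sup>2) \<longlonglongrightarrow> (norm (x - p))\<^sup>2"
    by (intro tendsto_intros p)
  moreover have "(\<lambda>n. d\<^sup>2 + inverse (real (Suc n))) \<longlonglongrightarrow> d\<^sup>2 + 0"
    by (intro tendsto_intros LIMSEQ_inverse_real_of_nat)
  ultimately have "(norm (x - p))\<^sup>2 \<le> d\<^sup>2 + 0"
    by (rule LIMSEQ_le) (intro exI[of _ 0] allI impI less_imp_le[OF m])
  then have min: "(norm (x - p))\<^sup>2 \<le> d\<^sup>2" by simp
  have "cinner (x - p) v = 0" if v: "v \<in> M" for v
  proof (cases "v = 0")
    case False
    define c where "c = cinner (x - p) v / complex_of_real ((norm v)\<^sup>2)"
    have "p + c *\<^sub>C v \<in> M"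
      by (simp add: cvec.subspace_scale[OF sub] cvec.subspace_add[OF sub] pM v)
    then have "d\<^sup>2 \<le> (norm ((x - p) - c *\<^sub>C v))\<^sup>2" using d2[of "p + c *\<^sub>C v"]
      by (simp add: diff_diff_eq)
    then have "(cmod (cinner (x - p) v))\<^sup>2 / (norm v)\<^sup>2 \<le> 0"
      using min norm_diff_scaleC_sq[OF False, of "x - p"] by (simp add: c_def)
    then show ?thesis using False by (simp add: divide_le_0_iff)
  qed simp
  then show ?thesis using that pM by blast
qed

lemma riesz_representation:
  fixes f :: "'a::complex_hilbert \<Rightarrow> complex"
  assumes f: "bounded_linear f" and fC: "\<And>c x. f (c *\<^sub>C x) = c * f x"
  obtains y where "\<And>x. f x = cinner x y"
proof (cases "\<forall>x. f x = 0")
  case True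
  then show ?thesis using that[of 0] by simp
next
  case False
  then obtain x0 where x0: "f x0 \<noteq> 0" by auto
  note ls = linear_simps[OF f]
  have "closed {x. f x = 0}"
    by (intro closed_Collect_eq continuous_on_const linear_continuous_on f)
  moreover have "cvec.subspace {x. f x = 0}"
    by (auto simp: cvec.subspace_def ls fC)
  ultimately obtain p where p: "f p = 0" and orth: "\<And>m. f m = 0 \<Longrightarrow> cinner (x0 - p) m = 0"
    using projection_exists[of "{x. f x = 0}" x0] by auto
  define u where "u = x0 - p"
  have fu: "f u \<noteq> 0" using x0 p by (simp add: u_def ls)
  then have u0: "u \<noteq> 0" using ls(5) by (auto simp: ls)
  have "f x = cinner x ((cnj (f u) / complex_of_real ((norm u)\<^sup>2)) *\<^sub>C u)" for x
  proof -
    have "f (f u *\<^sub>C x - f x *\<^sub>C u) = 0" by (simp add: ls fC)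
    then have "cinner u (f u *\<^sub>C x - f x *\<^sub>C u) = 0" using orth by (simp add: u_def)
    then have "cinner (f u *\<^sub>C x - f x *\<^sub>C u) u = 0" using cinner_commute[of _ u] by simp
    then have "f u * cinner x u = f x * complex_of_real ((norm u)\<^sup>2)"
      by (simp add: cinner_diff_left cinner_scaleC_left cinner_self)
    then show ?thesis using u0 by (simp add: cinner_scaleC_right field_simps)
  qed
  then show ?thesis using that by blast
qed

lemma cinner_eqI: "(\<And>x. cinner x y = cinner x z) \<Longrightarrow> y = z"
proof -
  assume "\<And>x. cinner x y = cinner x z"
  then have "cinner (y - z) (y - z) = 0" by (simp add: cinner_diff_right)
  then show ?thesis by (simp add: cinner_self)
qed

lemma cadjoint_eqI: "(\<And>x y. cinner (T x) y = cinner x (S y)) \<Longrightarrow> cadjoint T = S"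
  unfolding cadjoint_def by (rule the_equality, simp, rule ext, rule cinner_eqI) metis

lemma cinner_cadjoint:
  assumes T: "bounded_clinear T"
  shows "cinner (T x) y = cinner x (cadjoint T y)"
proof -
  obtain K where K: "\<And>x. norm (T x) \<le> K * norm x" using bounded_clinear_bound[OF T] by blast
  have "\<exists>z. \<forall>x. cinner (T x) y = cinner x z" for y
  proof -
    have "bounded_linear (\<lambda>x. cinner (T x) y)"
    proof (rule bounded_linear_intro[where K = "K * norm y"])
      show "norm (cinner (T x) y) \<le> norm x * (K * norm y)" for x
        using Cauchy_Schwarz[of "T x" y] mult_right_mono[OF K[of x], of "norm y"]
        by (simp add: mult_ac)
    qed (simp_all add: bounded_clinear_add[OF T] bounded_clinear_scaleC[OF T] cinner_add_left
        cinner_scaleC_left scaleR_scaleC scaleR_conv_of_real)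
    then obtain z where "\<And>x. cinner (T x) y = cinner x z"
      by (rule riesz_representation)
        (auto simp: bounded_clinear_scaleC[OF T] cinner_scaleC_left)
    then show ?thesis by blast
  qed
  then obtain S where S: "\<And>x y. cinner (T x) y = cinner x (S y)" by metis
  then show ?thesis using cadjoint_eqI[of T S] by simp
qed

lemma bounded_clinear_cadjoint:
  assumes T: "bounded_clinear T"
  shows "bounded_clinear (cadjoint T)"
proof -
  obtain K where K0: "K \<ge> 0" and K: "\<And>x. norm (T x) \<le> K * norm x"
    using bounded_clinear_bound[OF T] by blast
  show ?thesis
  proof (rule bounded_clinearI[where K = K])
    show "cadjoint T (x + y) = cadjoint T x + cadjoint T y" for x y
      by (rule cinner_eqI) (simp add: cinner_add_right flip: cinner_cadjoint[OF T])
    show "cadjoint T (c *\<^sub>C x) = c *\<^sub>C cadjoint T x" for c x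
      by (rule cinner_eqI) (simp add: cinner_scaleC_right flip: cinner_cadjoint[OF T])
    show "norm (cadjoint T y) \<le> K * norm y" for y
    proof (cases "cadjoint T y = 0")
      case False
      define z where "z = cadjoint T y"
      have "(norm z)\<^sup>2 = cmod (cinner (T z) y)"
        by (simp add: z_def cinner_cadjoint[OF T] cinner_self norm_power)
      also have "\<dots> \<le> norm (T z) * norm y" by (rule Cauchy_Schwarz)
      also have "\<dots> \<le> (K * norm z) * norm y" by (intro mult_right_mono K) simp
      finally have "norm z * norm z \<le> norm z * (K * norm y)"
        by (simp add: power2_eq_square mult_ac)
      then show ?thesis using False by (simp add: z_def)
    qed (simp add: K0)
  qed
qed

lemma cadjoint_cadjoint: "bounded_clinear T \<Longrightarrow> cadjoint (cadjoint T) = T"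
  by (rule cadjoint_eqI) (metis cinner_cadjoint cinner_commute)

lemma hyponormal_iff:
  assumes T: "bounded_clinear T"
  shows "hyponormal T \<longleftrightarrow> (\<forall>x. norm (cadjoint T x) \<le> norm (T x))"
proof -
  have "cinner (cadjoint T (T x) - T (cadjoint T x)) x
      = complex_of_real ((norm (T x))\<^sup>2 - (norm (cadjoint T x))\<^sup>2)" for x
    using cinner_cadjoint[OF T, of x "T x"] cinner_cadjoint[OF T, of "cadjoint T x" x]
      cinner_commute[of "cadjoint T (T x)" x] cinner_self[of "T x"]
      cinner_self[of "cadjoint T x"]
    by (metis cinner_diff_left complex_cnj_complex_of_real of_real_diff)
  then show ?thesis
    by (simp add: hyponormal_def positive_op_def abs_le_square_iff
        del: of_real_diff of_real_power)
qed


section \<open>Orthonormal bases\<close>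

lemma orthonormal_expansion:
  assumes "finite G" "is_orthonormal G"
  shows "(norm (x - (\<Sum>e\<in>G. c e *\<^sub>C e)))\<^sup>2
    = (norm x)\<^sup>2 - (\<Sum>e\<in>G. (cmod (cinner x e))\<^sup>2) + (\<Sum>e\<in>G. (cmod (cinner x e - c e))\<^sup>2)"
  using assms
proof (induction G rule: finite_induct)
  case (insert e G)
  define u where "u = x - (\<Sum>e\<in>G. c e *\<^sub>C e)"
  have G: "is_orthonormal G" and e: "norm e = 1" and orth: "\<And>f. f \<in> G \<Longrightarrow> cinner f e = 0"
    using insert.prems insert.hyps by (auto simp: is_orthonormal_def)
  have "cinner (\<Sum>e\<in>G. c e *\<^sub>C e) e = (\<Sum>f\<in>G. cinner (c f *\<^sub>C f) e)"
    by (induction G rule: infinite_finite_induct) (simp_all add: cinner_add_left)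
  then have ue: "cinner u e = cinner x e"
    by (simp add: u_def cinner_diff_left cinner_scaleC_left orth)
  have id: "- 2 * Re (cnj c * a) + (cmod c)\<^sup>2 = (cmod (a - c))\<^sup>2 - (cmod a)\<^sup>2" for a c
    by (simp add: cmod_power2) (simp add: power2_eq_square algebra_simps)
  have "x - (\<Sum>e\<in>insert e G. c e *\<^sub>C e) = u - c e *\<^sub>C e"
    using insert.hyps by (simp add: u_def algebra_simps)
  then have "(norm (x - (\<Sum>e\<in>insert e G. c e *\<^sub>C e)))\<^sup>2
      = (norm u)\<^sup>2 - 2 * Re (cnj (c e) * cinner x e) + (cmod (c e))\<^sup>2"
    by (simp add: norm_diff_sq cinner_scaleC_right ue norm_scaleC e)
  then show ?case
    using insert.IH[OF G] insert.hyps id[of "c e" "cinner x e"] by (simp add: u_def)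
qed simp

lemma parseval:
  assumes E: "is_onb E"
  shows "((\<lambda>e. (cmod (cinner x e))\<^sup>2) has_sum (norm x)\<^sup>2) E"
proof -
  have on: "is_orthonormal G" if "G \<subseteq> E" for G
    using E that unfolding is_onb_def is_orthonormal_def by (meson subsetD)
  show ?thesis
    unfolding has_sum_def tendsto_iff
  proof (intro allI impI)
    fix \<epsilon> :: real assume "\<epsilon> > 0"
    have "x \<in> closure (cspan E)" using E by (simp add: is_onb_def)
    moreover have "sqrt \<epsilon> > 0" using \<open>\<epsilon> > 0\<close> by simp
    ultimately obtain y where y: "y \<in> cspan E" "dist y x < sqrt \<epsilon>"
      unfolding closure_approachable by blast
    from y(1) obtain F r where F: "finite F" "F \<subseteq> E" "y = (\<Sum>e\<in>F. r e *\<^sub>C e)"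
      by (auto simp: cvec.span_explicit)
    have "dist (\<Sum>e\<in>G. (cmod (cinner x e))\<^sup>2) ((norm x)\<^sup>2) < \<epsilon>"
      if G: "finite G" "F \<subseteq> G" "G \<subseteq> E" for G
    proof -
      have "y = (\<Sum>e\<in>G. (if e \<in> F then r e else 0) *\<^sub>C e)"
        unfolding F(3) using G by (intro sum.mono_neutral_cong_left) auto
      then have "(norm x)\<^sup>2 - (\<Sum>e\<in>G. (cmod (cinner x e))\<^sup>2) \<le> (norm (x - y))\<^sup>2"
        using orthonormal_expansion[OF G(1) on[OF G(3)], of x "\<lambda>e. if e \<in> F then r e else 0"]
        by (simp add: sum_nonneg)
      also have "\<dots> < \<epsilon>"
        using power_strict_mono[OF y(2), of 2] \<open>\<epsilon> > 0\<close>
        by (simp add: dist_norm norm_minus_commute)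
      finally have "(norm x)\<^sup>2 - (\<Sum>e\<in>G. (cmod (cinner x e))\<^sup>2) < \<epsilon>" .
      moreover have "(\<Sum>e\<in>G. (cmod (cinner x e))\<^sup>2) \<le> (norm x)\<^sup>2"
        using orthonormal_expansion[OF G(1) on[OF G(3)], of x "cinner x"]
          zero_le_power2[of "norm (x - (\<Sum>e\<in>G. cinner x e *\<^sub>C e))"] by simp
      ultimately show ?thesis by (simp add: dist_real_def)
    qed
    then show "\<forall>\<^sub>F G in finite_subsets_at_top E.
        dist (\<Sum>e\<in>G. (cmod (cinner x e))\<^sup>2) ((norm x)\<^sup>2) < \<epsilon>"
      using F by (auto simp: eventually_finite_subsets_at_top)
  qed
qed

lemma subspace_closure_cspan: "cvec.subspace (closure (cspan E))"
  unfolding cvec.subspace_def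
proof (intro conjI ballI allI)
  show "0 \<in> closure (cspan E)" using cvec.span_zero closure_subset by blast
next
  fix x y assume "x \<in> closure (cspan E)" "y \<in> closure (cspan E)"
  then obtain f g where "\<And>n. f n \<in> cspan E" "f \<longlonglongrightarrow> x" "\<And>n. g n \<in> cspan E" "g \<longlonglongrightarrow> y"
    unfolding closure_sequential by blast
  then have "\<And>n. f n + g n \<in> cspan E" "(\<lambda>n. f n + g n) \<longlonglongrightarrow> x + y"
    by (auto intro: cvec.span_add tendsto_add)
  then show "x + y \<in> closure (cspan E)"
    unfolding closure_sequential by (intro exI[of _ "\<lambda>n. f n + g n"]) simp
next
  fix c x assume "x \<in> closure (cspan E)"
  then obtain f where "\<And>n. f n \<in> cspan E" "f \<longlonglongrightarrow> x"
    unfolding closure_sequential by blast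
  then have "\<And>n. c *\<^sub>C f n \<in> cspan E" "(\<lambda>n. c *\<^sub>C f n) \<longlonglongrightarrow> c *\<^sub>C x"
    by (auto intro: cvec.span_scale tendsto_scaleC)
  then show "c *\<^sub>C x \<in> closure (cspan E)"
    unfolding closure_sequential by (intro exI[of _ "\<lambda>n. c *\<^sub>C f n"]) simp
qed

lemma onb_exists: "\<exists>E :: 'a::complex_hilbert set. is_onb E"
proof -
  have "\<exists>U\<in>Collect is_orthonormal. \<forall>X\<in>C. X \<subseteq> U"
    if C: "subset.chain (Collect is_orthonormal) C" for C :: "'a set set"
  proof (intro bexI ballI)
    have on: "is_orthonormal X" if "X \<in> C" for X
      using C that by (auto simp: subset_chain_def)
    have "is_orthonormal (\<Union>C)"
      unfolding is_orthonormal_def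
    proof (intro conjI ballI impI)
      show "norm e = 1" if "e \<in> \<Union>C" for e
        using that on unfolding is_orthonormal_def by blast
      fix e f assume "e \<in> \<Union>C" "f \<in> \<Union>C" and ne: "e \<noteq> f"
      then obtain X Y where XY: "X \<in> C" "e \<in> X" "Y \<in> C" "f \<in> Y" by blast
      then have "X \<subseteq> Y \<or> Y \<subseteq> X"
        using C unfolding subset_chain_def by blast
      then obtain Z where "Z \<in> C" "e \<in> Z" "f \<in> Z" using XY by blast
      then show "cinner e f = 0"
        using ne on[of Z] unfolding is_orthonormal_def by blast
    qed
    then show "\<Union>C \<in> Collect is_orthonormal" by simp
  qed blast
  from subset_Zorn[OF this]
  obtain E :: "'a set" where E: "is_orthonormal E"
    and max: "\<And>X. is_orthonormal X \<Longrightarrow> E \<subseteq> X \<Longrightarrow> X = E"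
    by auto
  have "x \<in> closure (cspan E)" for x
  proof (rule ccontr)
    assume x: "x \<notin> closure (cspan E)"
    obtain p where p: "p \<in> closure (cspan E)"
      and orth: "\<And>m. m \<in> closure (cspan E) \<Longrightarrow> cinner (x - p) m = 0"
      using projection_exists[OF closed_closure subspace_closure_cspan] by metis
    have "x \<noteq> p" using x p by auto
    define u where "u = complex_of_real (inverse (norm (x - p))) *\<^sub>C (x - p)"
    have u1: "norm u = 1" using \<open>x \<noteq> p\<close> by (simp add: u_def norm_scaleC norm_inverse)
    have uo: "cinner u e = 0" if "e \<in> E" for e
      using orth[of e] that cvec.span_base[OF that] closure_subset
      by (auto simp: u_def cinner_scaleC_left)
    moreover have "cinner e u = 0" if "e \<in> E" for e
      using uo[OF that] cinner_commute[of e u] by simp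
    ultimately have "is_orthonormal (insert u E)"
      using E u1 by (auto simp: is_orthonormal_def)
    then have "u \<in> E" using max[of "insert u E"] by auto
    then show False using uo[of u] u1 by (simp add: cinner_self)
  qed
  then show ?thesis using E by (auto simp: is_onb_def)
qed


section \<open>Hilbert-Schmidt operators\<close>

lemma has_sum_swap_nonneg:
  fixes g :: "'a \<Rightarrow> 'b \<Rightarrow> real"
  assumes g: "\<And>x y. g x y \<ge> 0"
    and a: "\<And>x. x \<in> A \<Longrightarrow> (g x has_sum a x) B"
    and b: "\<And>y. y \<in> B \<Longrightarrow> ((\<lambda>x. g x y) has_sum b y) A"
    and s: "(a has_sum t) A"
  shows "(b has_sum t) B"
proof -
  have ia: "infsum (g x) B = a x" if "x \<in> A" for x using a[OF that] infsumI by blast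
  have ib: "infsum (\<lambda>x. g x y) A = b y" if "y \<in> B" for y using b[OF that] infsumI by blast
  have "(\<lambda>x. infsum (g x) B) summable_on A"
    by (rule summable_on_cong[THEN iffD2, OF ia has_sum_imp_summable[OF s]])
  then have "(\<lambda>p. norm (case p of (x, y) \<Rightarrow> g x y)) summable_on A \<times> B"
    unfolding Infinite_Sum.abs_summable_on_Sigma_iff
    using has_sum_imp_summable[OF a] g by (auto simp: infsum_nonneg)
  then have sm: "(\<lambda>(x, y). g x y) summable_on A \<times> B"
    by (rule abs_summable_summable)
  then have "(\<lambda>(y, x). g x y) summable_on B \<times> A"
    by (subst (asm) summable_on_swap) simp
  then have "(\<lambda>y. infsum (\<lambda>x. g x y) A) summable_on B"
    using summable_on_Sigma_banach[of "\<lambda>y x. g x y" B "\<lambda>_. A"] by simp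
  then have "((\<lambda>y. infsum (\<lambda>x. g x y) A) has_sum (infsum (\<lambda>y. infsum (\<lambda>x. g x y) A) B)) B"
    by (rule has_sum_infsum)
  moreover have "infsum (\<lambda>y. infsum (\<lambda>x. g x y) A) B = infsum (\<lambda>x. infsum (g x) B) A"
    using infsum_swap_banach[OF sm] by simp
  moreover have "infsum (\<lambda>x. infsum (g x) B) A = t"
    by (rule trans[OF infsum_cong[OF ia] infsumI[OF s]])
  ultimately have "((\<lambda>y. infsum (\<lambda>x. g x y) A) has_sum t) B" by simp
  moreover have "((\<lambda>y. infsum (\<lambda>x. g x y) A) has_sum t) B \<longleftrightarrow> (b has_sum t) B"
    by (rule has_sum_cong) (rule ib)
  ultimately show ?thesis by blast
qed

lemma has_sum_cadjoint:
  assumes T: "bounded_clinear T" and E: "is_onb E" and F: "is_onb F"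
    and s: "((\<lambda>e. (norm (T e))\<^sup>2) has_sum t) E"
  shows "((\<lambda>f. (norm (cadjoint T f))\<^sup>2) has_sum t) F"
proof (rule has_sum_swap_nonneg[OF _ _ _ s])
  show "((\<lambda>f. (cmod (cinner (T e) f))\<^sup>2) has_sum (norm (T e))\<^sup>2) F" for e
    by (rule parseval[OF F])
  have "cmod (cinner (T e) f) = cmod (cinner (cadjoint T f) e)" for e f
    using cinner_cadjoint[OF T, of e f] cinner_commute[of e "cadjoint T f"] by simp
  then show "((\<lambda>e. (cmod (cinner (T e) f))\<^sup>2) has_sum (norm (cadjoint T f))\<^sup>2) E" for f
    using parseval[OF E, of "cadjoint T f"] by simp
qed simp

lemma has_sum_onb_indep:
  fixes T :: "'a::complex_hilbert \<Rightarrow> 'a"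
  assumes T: "bounded_clinear T" and E: "is_onb E" and F: "is_onb F"
    and s: "((\<lambda>e. (norm (T e))\<^sup>2) has_sum t) E"
  shows "((\<lambda>e. (norm (T e))\<^sup>2) has_sum t) F"
  using has_sum_cadjoint[OF bounded_clinear_cadjoint[OF T] E F has_sum_cadjoint[OF T E E s]]
  by (simp add: cadjoint_cadjoint[OF T])

lemma hs_norm_nonneg: "hs_norm T \<ge> 0"
  by (simp add: hs_norm_def infsum_nonneg)

lemma hs_norm_has_sum:
  assumes T: "is_hilbert_schmidt T" and E: "is_onb E"
  shows "((\<lambda>e. (norm (T e))\<^sup>2) has_sum (hs_norm T)\<^sup>2) E"
proof -
  have B: "is_onb (SOME E::'a set. is_onb E)" using onb_exists by (rule someI_ex)
  obtain F t where F: "is_onb F" "((\<lambda>e. (norm (T e))\<^sup>2) has_sum t) F" and bT: "bounded_clinear T"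
    using T unfolding is_hilbert_schmidt_def summable_on_def by blast
  have "(hs_norm T)\<^sup>2 = t"
    using infsumI[OF has_sum_onb_indep[OF bT F(1) B F(2)]] has_sum_nonneg[OF F(2)]
    by (simp add: hs_norm_def)
  then show ?thesis using has_sum_onb_indep[OF bT F(1) E F(2)] by simp
qed

lemma hs_bounded: "is_hilbert_schmidt T \<Longrightarrow> bounded_clinear T"
  by (simp add: is_hilbert_schmidt_def)

lemma hs_cadjoint:
  assumes T: "is_hilbert_schmidt T"
  shows "is_hilbert_schmidt (cadjoint T)" "hs_norm (cadjoint T) = hs_norm T"
proof -
  obtain E :: "'a set" where E: "is_onb E" using onb_exists by blast
  note * = has_sum_cadjoint[OF hs_bounded[OF T] E E hs_norm_has_sum[OF T E]]
  show hs: "is_hilbert_schmidt (cadjoint T)"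
    using * E bounded_clinear_cadjoint[OF hs_bounded[OF T]]
    by (auto simp: is_hilbert_schmidt_def dest: has_sum_imp_summable)
  show "hs_norm (cadjoint T) = hs_norm T"
    using has_sum_unique[OF * hs_norm_has_sum[OF hs E]] hs_norm_nonneg
    by (metis power2_eq_imp_eq)
qed

lemma L2_set_le_hs_norm:
  assumes T: "is_hilbert_schmidt T" and E: "is_onb E" and G: "finite G" "G \<subseteq> E"
  shows "L2_set (\<lambda>e. norm (T e)) G \<le> hs_norm T"
proof -
  have "(\<Sum>e\<in>G. (norm (T e))\<^sup>2) \<le> (hs_norm T)\<^sup>2"
    using G hs_norm_has_sum[OF T E] by (intro has_sum_mono_neutral[OF has_sum_finite]) auto
  then show ?thesis
    unfolding L2_set_def by (simp add: hs_norm_nonneg real_le_lsqrt sum_nonneg)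
qed

lemma hs_boundI:
  assumes T: "bounded_clinear T" and E: "is_onb E"
    and K: "\<And>G. finite G \<Longrightarrow> G \<subseteq> E \<Longrightarrow> L2_set (\<lambda>e. norm (T e)) G \<le> K"
  shows "is_hilbert_schmidt T" "hs_norm T \<le> K"
proof -
  have K0: "K \<ge> 0" using K[of "{}"] by simp
  have b: "(\<Sum>e\<in>G. (norm (T e))\<^sup>2) \<le> K\<^sup>2" if "finite G" "G \<subseteq> E" for G
    using K[OF that] unfolding L2_set_def by (rule sqrt_le_D)
  have sm: "(\<lambda>e. (norm (T e))\<^sup>2) summable_on E"
    using b by (intro nonneg_bdd_above_summable_on bdd_aboveI[where M = "K\<^sup>2"]) auto
  then show hs: "is_hilbert_schmidt T" using T E by (auto simp: is_hilbert_schmidt_def)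
  have "(hs_norm T)\<^sup>2 \<le> K\<^sup>2"
    using infsum_le_finite_sums[OF sm b] infsumI[OF hs_norm_has_sum[OF hs E]] by simp
  then show "hs_norm T \<le> K" using K0 by (rule power2_le_imp_le)
qed

lemma norm_le_hs_norm:
  assumes T: "is_hilbert_schmidt T"
  shows "norm (T x) \<le> hs_norm T * norm x"
proof -
  obtain E :: "'a set" where E: "is_onb E" using onb_exists by blast
  have "(cmod (cinner (T x) e))\<^sup>2 \<le> (norm (cadjoint T e))\<^sup>2 * (norm x)\<^sup>2" for e
    using power_mono[OF Cauchy_Schwarz[of x "cadjoint T e"], of 2]
    by (simp add: cinner_cadjoint[OF hs_bounded[OF T]] power_mult_distrib mult.commute)
  then have "(norm (T x))\<^sup>2 \<le> (hs_norm T)\<^sup>2 * (norm x)\<^sup>2"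
    using has_sum_cmult_left[OF hs_norm_has_sum[OF hs_cadjoint(1)[OF T] E], of "(norm x)\<^sup>2"]
    by (intro has_sum_mono[OF parseval[OF E, of "T x"]]) (auto simp: hs_cadjoint(2)[OF T])
  then show ?thesis
    by (metis hs_norm_nonneg mult_nonneg_nonneg norm_ge_zero power2_le_imp_le power_mult_distrib)
qed

lemma hs_zero: "is_hilbert_schmidt (\<lambda>x. 0)" "hs_norm (\<lambda>x. 0) = 0"
  using onb_exists
  by (auto simp: is_hilbert_schmidt_def bounded_clinear_def hs_norm_def)

lemma hs_add:
  assumes S: "is_hilbert_schmidt S" and T: "is_hilbert_schmidt T"
  shows "is_hilbert_schmidt (\<lambda>x. S x + T x)" "hs_norm (\<lambda>x. S x + T x) \<le> hs_norm S + hs_norm T"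
proof -
  obtain E :: "'a set" where E: "is_onb E" using onb_exists by blast
  have "bounded_clinear (\<lambda>x. S x + T x)"
    using hs_bounded[OF S] hs_bounded[OF T]
    by (simp add: bounded_clinear_def bounded_linear_add scaleC_add_right)
  moreover have "L2_set (\<lambda>e. norm (S e + T e)) G \<le> hs_norm S + hs_norm T"
    if G: "finite G" "G \<subseteq> E" for G
  proof -
    have "L2_set (\<lambda>e. norm (S e + T e)) G \<le> L2_set (\<lambda>e. norm (S e) + norm (T e)) G"
      by (intro L2_set_mono norm_triangle_ineq) simp
    also have "\<dots> \<le> L2_set (\<lambda>e. norm (S e)) G + L2_set (\<lambda>e. norm (T e)) G"
      by (rule L2_set_triangle_ineq)
    also have "\<dots> \<le> hs_norm S + hs_norm T"
      by (intro add_mono L2_set_le_hs_norm[OF S E G] L2_set_le_hs_norm[OF T E G])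
    finally show ?thesis .
  qed
  ultimately show "is_hilbert_schmidt (\<lambda>x. S x + T x)"
    "hs_norm (\<lambda>x. S x + T x) \<le> hs_norm S + hs_norm T"
    using hs_boundI[OF _ E] by blast+
qed

lemma hs_compose_left:
  assumes A: "bounded_clinear A" and T: "is_hilbert_schmidt T"
  shows "is_hilbert_schmidt (\<lambda>x. A (T x))"
proof -
  obtain E :: "'a set" where E: "is_onb E" using onb_exists by blast
  obtain K where K: "K \<ge> 0" "\<And>x. norm (A x) \<le> K * norm x"
    using bounded_clinear_bound[OF A] by blast
  have "L2_set (\<lambda>e. norm (A (T e))) G \<le> K * hs_norm T" if G: "finite G" "G \<subseteq> E" for G
  proof -
    have "L2_set (\<lambda>e. norm (A (T e))) G \<le> L2_set (\<lambda>e. K * norm (T e)) G"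
      by (intro L2_set_mono K) simp
    also have "\<dots> = K * L2_set (\<lambda>e. norm (T e)) G" by (simp add: L2_set_right_distrib K(1))
    also have "\<dots> \<le> K * hs_norm T" by (intro mult_left_mono L2_set_le_hs_norm[OF T E G] K(1))
    finally show ?thesis .
  qed
  then show ?thesis
    by (rule hs_boundI(1)[OF bounded_clinear_compose[OF A hs_bounded[OF T]] E])
qed

lemma hs_compose_right:
  assumes B: "bounded_clinear B" and T: "is_hilbert_schmidt T"
  shows "is_hilbert_schmidt (\<lambda>x. T (B x))"
proof -
  have "cadjoint (\<lambda>y. cadjoint B (cadjoint T y)) = (\<lambda>x. T (B x))"
    by (rule cadjoint_eqI)
      (metis B T cadjoint_cadjoint cinner_cadjoint bounded_clinear_cadjoint hs_bounded)
  then show ?thesis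
    using hs_cadjoint(1)[OF hs_compose_left[OF bounded_clinear_cadjoint[OF B] hs_cadjoint(1)[OF T]]]
    by simp
qed

lemma bounded_clinear_scaleC_left:
  "bounded_clinear (\<lambda>x::'a::complex_normed_vector. c *\<^sub>C x)"
  by (simp add: bounded_clinear_def bounded_linear_scaleC scaleC_scaleC mult.commute)

lemma hs_scaleC:
  assumes T: "is_hilbert_schmidt T"
  shows "is_hilbert_schmidt (\<lambda>x. c *\<^sub>C T x)" "hs_norm (\<lambda>x. c *\<^sub>C T x) = cmod c * hs_norm T"
proof -
  show "is_hilbert_schmidt (\<lambda>x. c *\<^sub>C T x)"
    by (rule hs_compose_left[OF bounded_clinear_scaleC_left T])
  show "hs_norm (\<lambda>x. c *\<^sub>C T x) = cmod c * hs_norm T"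
    by (simp add: hs_norm_def norm_scaleC power_mult_distrib infsum_cmult_right' real_sqrt_mult)
qed

lemma hs_diff:
  assumes S: "is_hilbert_schmidt S" and T: "is_hilbert_schmidt T"
  shows "is_hilbert_schmidt (\<lambda>x. S x - T x)"
  using hs_add(1)[OF S hs_scaleC(1)[OF T, of "- 1"]]
  by (simp add: scaleC_one cvec.scale_minus_left)

typedef (overloaded) 'a hilbert_schmidt = "{T :: 'a::complex_hilbert \<Rightarrow> 'a. is_hilbert_schmidt T}"
  morphisms hs_apply Abs_hilbert_schmidt
  using hs_zero(1) by blast

setup_lifting type_definition_hilbert_schmidt

instantiation hilbert_schmidt :: (complex_hilbert) complex_normed_vector
begin

lift_definition zero_hilbert_schmidt :: "'a hilbert_schmidt" is "\<lambda>x. 0" by (rule hs_zero)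
lift_definition plus_hilbert_schmidt :: "'a hilbert_schmidt \<Rightarrow> 'a hilbert_schmidt \<Rightarrow> 'a hilbert_schmidt"
  is "\<lambda>S T x. S x + T x" by (rule hs_add)
lift_definition minus_hilbert_schmidt :: "'a hilbert_schmidt \<Rightarrow> 'a hilbert_schmidt \<Rightarrow> 'a hilbert_schmidt"
  is "\<lambda>S T x. S x - T x" by (rule hs_diff)
lift_definition uminus_hilbert_schmidt :: "'a hilbert_schmidt \<Rightarrow> 'a hilbert_schmidt"
  is "\<lambda>T x. - T x" using hs_diff[OF hs_zero(1)] by simp
lift_definition scaleC_hilbert_schmidt :: "complex \<Rightarrow> 'a hilbert_schmidt \<Rightarrow> 'a hilbert_schmidt"
  is "\<lambda>c T x. c *\<^sub>C T x" by (rule hs_scaleC)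
lift_definition norm_hilbert_schmidt :: "'a hilbert_schmidt \<Rightarrow> real" is hs_norm .

definition scaleR_hilbert_schmidt :: "real \<Rightarrow> 'a hilbert_schmidt \<Rightarrow> 'a hilbert_schmidt"
  where "scaleR_hilbert_schmidt r T = complex_of_real r *\<^sub>C T"
definition dist_hilbert_schmidt :: "'a hilbert_schmidt \<Rightarrow> 'a hilbert_schmidt \<Rightarrow> real"
  where "dist_hilbert_schmidt S T = norm (S - T)"
definition sgn_hilbert_schmidt :: "'a hilbert_schmidt \<Rightarrow> 'a hilbert_schmidt"
  where "sgn_hilbert_schmidt T = inverse (norm T) *\<^sub>R T"
definition uniformity_hilbert_schmidt :: "('a hilbert_schmidt \<times> 'a hilbert_schmidt) filter"
  where "uniformity_hilbert_schmidt = (INF e\<in>{0<..}. principal {(S, T). dist S T < e})"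
definition open_hilbert_schmidt :: "'a hilbert_schmidt set \<Rightarrow> bool"
  where "open_hilbert_schmidt U = (\<forall>S\<in>U. eventually (\<lambda>(S', T). S' = S \<longrightarrow> T \<in> U) uniformity)"

instance
proof
  fix S T R :: "'a hilbert_schmidt" and a b :: complex and r s :: real
  show "S + T + R = S + (T + R)" "S + T = T + S" "0 + S = S" "- S + S = 0" "S - T = S + - T"
    by (transfer; simp add: add_ac)+
  show ar: "a *\<^sub>C (S + T) = a *\<^sub>C S + a *\<^sub>C T"
    by transfer (simp add: scaleC_add_right)
  show al: "(a + b) *\<^sub>C S = a *\<^sub>C S + b *\<^sub>C S"
    by transfer (simp add: scaleC_add_left)
  show sc: "a *\<^sub>C b *\<^sub>C S = (a * b) *\<^sub>C S"
    by transfer (simp add: scaleC_scaleC)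
  show nm: "norm (a *\<^sub>C S) = cmod a * norm S"
    by transfer (simp add: hs_scaleC)
  show "r *\<^sub>R S = complex_of_real r *\<^sub>C S" by (rule scaleR_hilbert_schmidt_def)
  show "r *\<^sub>R (S + T) = r *\<^sub>R S + r *\<^sub>R T"
    unfolding scaleR_hilbert_schmidt_def by transfer (simp add: scaleC_add_right)
  show "(r + s) *\<^sub>R S = r *\<^sub>R S + s *\<^sub>R S"
    unfolding scaleR_hilbert_schmidt_def by transfer (simp add: scaleC_add_left)
  show "r *\<^sub>R s *\<^sub>R S = (r * s) *\<^sub>R S"
    unfolding scaleR_hilbert_schmidt_def by transfer (simp add: scaleC_scaleC)
  show "1 *\<^sub>R S = S"
    unfolding scaleR_hilbert_schmidt_def by transfer (simp add: scaleC_one)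
  show "norm (r *\<^sub>R S) = \<bar>r\<bar> * norm S"
    unfolding scaleR_hilbert_schmidt_def by transfer (simp add: hs_scaleC)
  show "norm (S + T) \<le> norm S + norm T"
    by transfer (rule hs_add)
  show "norm S = 0 \<longleftrightarrow> S = 0"
  proof transfer
    fix S :: "'a \<Rightarrow> 'a" assume "is_hilbert_schmidt S"
    then show "hs_norm S = 0 \<longleftrightarrow> S = (\<lambda>x. 0)"
      using norm_le_hs_norm[of S] hs_zero(2) by auto
  qed
qed (simp_all add: dist_hilbert_schmidt_def sgn_hilbert_schmidt_def
    uniformity_hilbert_schmidt_def open_hilbert_schmidt_def)

end

instance hilbert_schmidt :: (complex_hilbert) complex_banach
proof
  fix X :: "nat \<Rightarrow> 'a hilbert_schmidt" assume X: "Cauchy X"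
  obtain E :: "'a set" where E: "is_onb E" using onb_exists by blast
  let ?T = "\<lambda>n. hs_apply (X n)"
  have hs: "is_hilbert_schmidt (?T n)" for n using hs_apply by auto
  have bound: "norm (?T n x - ?T k x) \<le> norm (X n - X k) * norm x" for n k x
    using norm_le_hs_norm[OF hs_diff[OF hs[of n] hs[of k]], of x]
    by (simp add: norm_hilbert_schmidt.rep_eq minus_hilbert_schmidt.rep_eq)
  have "Cauchy (\<lambda>n. ?T n x)" for x
  proof (rule CauchyI)
    fix e :: real assume "e > 0"
    then obtain N where N: "\<And>n k. n \<ge> N \<Longrightarrow> k \<ge> N \<Longrightarrow> norm (X n - X k) < e / (norm x + 1)"
      using CauchyD[OF X, of "e / (norm x + 1)"] by (auto simp: add_nonneg_pos)
    have "norm (?T n x - ?T k x) < e" if "n \<ge> N" "k \<ge> N" for n k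
    proof -
      have "norm (X n - X k) * (norm x + 1) < e"
        using N[OF that] by (simp add: pos_less_divide_eq add_nonneg_pos)
      moreover have "norm (X n - X k) * norm x \<le> norm (X n - X k) * (norm x + 1)"
        by (intro mult_left_mono) auto
      ultimately show ?thesis using bound[of n x k] by linarith
    qed
    then show "\<exists>M. \<forall>m\<ge>M. \<forall>n\<ge>M. norm (?T m x - ?T n x) < e" by blast
  qed
  then have L: "(\<lambda>n. ?T n x) \<longlonglongrightarrow> lim (\<lambda>n. ?T n x)" for x
    using Cauchy_convergent convergent_LIMSEQ_iff by blast
  define L where "L x = lim (\<lambda>n. ?T n x)" for x
  note L = L[folded L_def]
  obtain K where K: "\<And>n. norm (X n) \<le> K"
    using Cauchy_Bseq[OF X] by (auto simp: Bseq_def)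
  have bL: "bounded_clinear L"
  proof (rule bounded_clinearI[where K = K])
    fix x y c
    have "(\<lambda>n. ?T n (x + y)) \<longlonglongrightarrow> L x + L y"
      using tendsto_add[OF L[of x] L[of y]] by (simp add: bounded_clinear_add[OF hs_bounded[OF hs]])
    then show "L (x + y) = L x + L y" using LIMSEQ_unique L by blast
    have "(\<lambda>n. ?T n (c *\<^sub>C x)) \<longlonglongrightarrow> c *\<^sub>C L x"
      using tendsto_scaleC[OF L[of x]] by (simp add: bounded_clinear_scaleC[OF hs_bounded[OF hs]])
    then show "L (c *\<^sub>C x) = c *\<^sub>C L x" using LIMSEQ_unique L by blast
    have "norm (?T n x) \<le> K * norm x" for n
      using norm_le_hs_norm[OF hs, of n x] mult_right_mono[OF K[of n], of "norm x"]
      by (simp add: norm_hilbert_schmidt.rep_eq)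
    then show "norm (L x) \<le> K * norm x"
      by (intro tendsto_upperbound[OF tendsto_norm[OF L]]) auto
  qed
  have close: "is_hilbert_schmidt (\<lambda>x. ?T n x - L x) \<and> hs_norm (\<lambda>x. ?T n x - L x) \<le> e"
    if e: "\<And>k. k \<ge> N \<Longrightarrow> norm (X n - X k) \<le> e" for n N e
  proof -
    have "bounded_clinear (\<lambda>x. ?T n x - L x)"
      using hs_bounded[OF hs[of n]] bL
      by (simp add: bounded_clinear_def bounded_linear_sub cvec.scale_right_diff_distrib)
    moreover have "L2_set (\<lambda>x. norm (?T n x - L x)) G \<le> e" if G: "finite G" "G \<subseteq> E" for G
    proof (rule tendsto_upperbound)
      show "(\<lambda>k. L2_set (\<lambda>x. norm (?T n x - ?T k x)) G)
          \<longlonglongrightarrow> L2_set (\<lambda>x. norm (?T n x - L x)) G"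
        unfolding L2_set_def by (intro tendsto_intros L)
      have "L2_set (\<lambda>x. norm (?T n x - ?T k x)) G \<le> e" if "k \<ge> N" for k
        using L2_set_le_hs_norm[OF hs_diff[OF hs[of n] hs[of k]] E G] e[OF that]
        by (simp add: norm_hilbert_schmidt.rep_eq minus_hilbert_schmidt.rep_eq)
      then show "\<forall>\<^sub>F k in sequentially. L2_set (\<lambda>x. norm (?T n x - ?T k x)) G \<le> e"
        unfolding eventually_sequentially by blast
    qed simp
    ultimately show ?thesis using hs_boundI[OF _ E] by blast
  qed
  obtain N where "\<And>n k. n \<ge> N \<Longrightarrow> k \<ge> N \<Longrightarrow> norm (X n - X k) < 1"
    using CauchyD[OF X, of 1] by auto
  then have "is_hilbert_schmidt (\<lambda>x. ?T N x - L x)"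
    using close[of N N 1] by (simp add: less_imp_le)
  then have hsL: "is_hilbert_schmidt L" using hs_diff[OF hs[of N]] by fastforce
  have "X \<longlonglongrightarrow> Abs_hilbert_schmidt L"
  proof (rule LIMSEQ_I)
    fix e :: real assume "e > 0"
    then obtain M where M: "\<And>n k. n \<ge> M \<Longrightarrow> k \<ge> M \<Longrightarrow> norm (X n - X k) < e / 2"
      using CauchyD[OF X, of "e / 2"] by auto
    have "norm (X n - Abs_hilbert_schmidt L) < e" if "n \<ge> M" for n
      using close[of M n "e / 2"] M[OF that] \<open>e > 0\<close> hsL
      by (force simp: norm_hilbert_schmidt.rep_eq minus_hilbert_schmidt.rep_eq
          Abs_hilbert_schmidt_inverse less_imp_le)
    then show "\<exists>M. \<forall>n\<ge>M. norm (X n - Abs_hilbert_schmidt L) < e" by blast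
  qed
  then show "convergent X" by (auto simp: convergent_def)
qed

text \<open>For bounded \<open>A\<close> and \<open>B\<close> the operator \<open>A T - T B\<close> is again Hilbert-Schmidt
  (\<open>hs_apply_gen_derivation\<close>); otherwise the value is unspecified.\<close>

definition gen_derivation ::
    "('a::complex_hilbert \<Rightarrow> 'a) \<Rightarrow> ('a \<Rightarrow> 'a) \<Rightarrow> 'a hilbert_schmidt \<Rightarrow> 'a hilbert_schmidt"
  where "gen_derivation A B T = Abs_hilbert_schmidt (\<lambda>x. A (hs_apply T x) - hs_apply T (B x))"

lemma hs_apply_gen_derivation:
  assumes "bounded_clinear A" "bounded_clinear B"
  shows "hs_apply (gen_derivation A B T) = (\<lambda>x. A (hs_apply T x) - hs_apply T (B x))"
  using hs_diff[OF hs_compose_left[OF assms(1)] hs_compose_right[OF assms(2)], of "hs_apply T" "hs_apply T"]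
    hs_apply[of T]
  by (simp add: gen_derivation_def Abs_hilbert_schmidt_inverse)

end

theory Submission
  imports Defs
begin

text \<open>
  The Hilbert-Schmidt operators form a Hilbert space, and there the generalised derivation
  \<open>\<tau>\<close> of \<open>A\<close> and \<open>B\<close> is itself hyponormal. Indeed \<open>\<tau> = L - R\<close>, where \<open>L\<close> is left multiplication
  by \<open>A\<close> and \<open>R\<close> is right multiplication by \<open>B\<close>; their adjoints are the multiplications by the
  adjoints of \<open>A\<close> and \<open>B\<close>. Left multiplications commute with right multiplications, so the mixed
  terms of \<open>\<parallel>\<tau> T\<parallel>\<^sup>2\<close> and of \<open>\<parallel>\<tau>\<^sup>* T\<parallel>\<^sup>2\<close> agree, and what is left to compare is \<open>\<parallel>A T\<parallel>\<close> with
  \<open>\<parallel>A\<^sup>* T\<parallel>\<close> and \<open>\<parallel>T B\<parallel> = \<parallel>B\<^sup>* T\<^sup>*\<parallel>\<close> with \<open>\<parallel>T B\<^sup>*\<parallel> = \<parallel>B T\<^sup>*\<parallel>\<close>. These are ordered by the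
  hyponormality of \<open>A\<close> and of \<open>B\<^sup>*\<close> (\<open>hyponormal_gen_derivation\<close>).

  It remains to see that a hyponormal operator \<open>U\<close> is not supercyclic once no single vector spans
  the space (\<open>hyponormal_not_supercyclic\<close>). Hyponormality gives
  \<open>\<parallel>U x\<parallel>\<^sup>2 \<le> \<parallel>U\<^sup>2 x\<parallel> \<parallel>x\<parallel>\<close>, so the growth quotient \<open>\<parallel>U z\<parallel> / \<parallel>z\<parallel>\<close> increases along orbits. If \<open>y\<close>
  is a supercyclic vector, its quotient is therefore minimal on the dense set of multiples of the
  orbit, hence on the whole space. But every \<open>U\<^sup>n y\<close> is supercyclic too, and so all these
  quotients are minimal, that is, equal: \<open>U\<close> is a multiple of an isometry. Now any bounded operator \<open>S\<close> that
  commutes with \<open>U\<close> satisfies \<open>\<parallel>S z\<parallel> \<parallel>y\<parallel> = \<parallel>S y\<parallel> \<parallel>z\<parallel>\<close> on the orbit of \<open>y\<close>, and hence everywhere.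
  Taking \<open>S = U - \<mu>\<close> for all scalars \<open>\<mu>\<close> and expanding the squared norm shows that the numerical
  range of \<open>U\<close> is one point, so \<open>U\<close> is a scalar and its orbits stay on a line.
\<close>

section \<open>Supercyclic vectors\<close>

definition supercyclic_vector :: "('a::complex_normed_vector \<Rightarrow> 'a) \<Rightarrow> 'a \<Rightarrow> bool"
  where "supercyclic_vector U y \<longleftrightarrow> closure {c *\<^sub>C (U ^^ n) y | c n. True} = UNIV"

lemma supercyclic_iff_vector: "supercyclic U \<longleftrightarrow> (\<exists>y. supercyclic_vector U y)"
  by (simp add: supercyclic_def supercyclic_vector_def)

text \<open>The form in which density is used below: a closed condition has to be checked only on
  multiples of the orbit.\<close>

lemma supercyclic_vector_closed:
  assumes "supercyclic_vector U y" and "closed {z. P z}"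
    and "\<And>c n. P (c *\<^sub>C (U ^^ n) y)"
  shows "P z"
proof -
  have "closure {c *\<^sub>C (U ^^ n) y | c n. True} \<subseteq> {z. P z}"
    using assms(2,3) by (intro closure_minimal) auto
  then show ?thesis using assms(1) by (auto simp: supercyclic_vector_def)
qed

text \<open>A line is the fixed point set of its orthogonal projection, which is continuous.\<close>

lemma closed_cspan_singleton: "closed (cspan {y :: 'a::complex_hilbert})"
proof (cases "y = 0")
  case False
  have span_iff: "z \<in> cspan {y} \<longleftrightarrow> z = (cinner z y / complex_of_real ((norm y)\<^sup>2)) *\<^sub>C y" for z
    using False
    by (auto simp: cvec.span_singleton cinner_scaleC_left cinner_self)
  have "bounded_linear (\<lambda>z. (cinner z y / complex_of_real ((norm y)\<^sup>2)) *\<^sub>C y)"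
  proof (rule bounded_linear_intro[where K = 1])
    show "norm ((cinner z y / complex_of_real ((norm y)\<^sup>2)) *\<^sub>C y) \<le> norm z * 1" for z
      using False Cauchy_Schwarz[of z y]
      by (simp add: norm_scaleC norm_divide norm_power norm_mult power2_eq_square field_simps)
  qed (simp_all add: cinner_add_left add_divide_distrib scaleC_add_left cinner_scaleC_left
      scaleR_scaleC scaleC_scaleC)
  then have "closed {z. z = (cinner z y / complex_of_real ((norm y)\<^sup>2)) *\<^sub>C y}"
    by (intro closed_Collect_eq continuous_on_id linear_continuous_on)
  moreover have "cspan {y} = {z. z = (cinner z y / complex_of_real ((norm y)\<^sup>2)) *\<^sub>C y}"
    using span_iff by blast
  ultimately show ?thesis by simp
qed simp

lemma bounded_clinear_continuous_on: "bounded_clinear U \<Longrightarrow> continuous_on X U"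
  by (simp add: bounded_clinear_def linear_continuous_on)

lemma bounded_clinear_sub:
  "bounded_clinear S \<Longrightarrow> bounded_clinear T \<Longrightarrow> bounded_clinear (\<lambda>x. S x - T x)"
  by (simp add: bounded_clinear_def cvec.scale_right_diff_distrib bounded_linear_sub[of S T])

lemma bounded_clinear_funpow:
  fixes U :: "'a::complex_normed_vector \<Rightarrow> 'a"
  shows "bounded_clinear U \<Longrightarrow> bounded_clinear (U ^^ n)"
proof (induction n)
  case (Suc n)
  then show ?case using bounded_clinear_compose[of U "U ^^ n"] by (simp add: comp_def)
qed (simp add: bounded_clinear_def id_def bounded_linear_ident)

text \<open>All orbit points after the first lie in the range of \<open>U\<close>. So the line through \<open>y\<close> and the
  closure of the range cover the space, and a vector space is not the union of two proper
  subspaces.\<close>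

lemma supercyclic_dense_range:
  fixes U :: "'a::complex_hilbert \<Rightarrow> 'a"
  assumes U: "bounded_clinear U" and y: "supercyclic_vector U y" and dim: "cspan {y} \<noteq> UNIV"
  shows "closure (range U) = UNIV"
proof (rule ccontr)
  assume nd: "closure (range U) \<noteq> UNIV"
  have "cvec.subspace (range U)"
    unfolding cvec.subspace_def
  proof (intro conjI ballI allI)
    show "0 \<in> range U" using bounded_clinear_scaleC[OF U, of 0 0] by (auto intro!: range_eqI[of _ _ 0])
  next
    fix a b assume "a \<in> range U" "b \<in> range U"
    then show "a + b \<in> range U" by (auto simp flip: bounded_clinear_add[OF U])
  next
    fix c a assume "a \<in> range U"
    then show "c *\<^sub>C a \<in> range U" by (auto simp flip: bounded_clinear_scaleC[OF U])
  qed
  then have "cspan (range U) = range U" by (simp add: cvec.span_eq_iff)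
  then have sub: "cvec.subspace (closure (range U))"
    using subspace_closure_cspan[of "range U"] by (simp only:)
  have covered: "z \<in> cspan {y} \<union> closure (range U)" for z
  proof (rule supercyclic_vector_closed[OF y, where P = "\<lambda>z. z \<in> cspan {y} \<union> closure (range U)"])
    show "closed {z. z \<in> cspan {y} \<union> closure (range U)}"
      unfolding Collect_mem_eq by (intro closed_Un closed_cspan_singleton closed_closure)
    show "c *\<^sub>C (U ^^ n) y \<in> cspan {y} \<union> closure (range U)" for c n
    proof (cases n)
      case 0
      then show ?thesis by (simp add: cvec.span_base cvec.span_scale)
    next
      case (Suc m)
      then have "c *\<^sub>C (U ^^ n) y = U (c *\<^sub>C (U ^^ m) y)" by (simp add: bounded_clinear_scaleC[OF U])
      then have "c *\<^sub>C (U ^^ n) y \<in> range U" by (simp only: rangeI)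
      then show ?thesis using closure_subset[of "range U"] by (intro UnI2) (rule subsetD)
    qed
  qed
  obtain v w where v: "v \<notin> closure (range U)" and w: "w \<notin> cspan {y}" using nd dim by blast
  then have "v \<in> cspan {y}" "w \<in> closure (range U)" using covered by blast+
  moreover have "w = (v + w) - v" "v = (v + w) - w" by simp_all
  ultimately have "v + w \<notin> cspan {y}" "v + w \<notin> closure (range U)"
    using v w cvec.span_diff cvec.subspace_diff[OF sub] by metis+
  then show False using covered by blast
qed

text \<open>A continuous map with dense range carries dense sets to dense sets, and \<open>U\<close> carries multiples
  of the orbit of \<open>y\<close> to multiples of the orbit of \<open>U y\<close>.\<close>

lemma supercyclic_vector_image:
  fixes U :: "'a::complex_hilbert \<Rightarrow> 'a"
  assumes U: "bounded_clinear U" and y: "supercyclic_vector U y" and dim: "cspan {y} \<noteq> UNIV"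
  shows "supercyclic_vector U (U y)"
proof -
  let ?O = "{c *\<^sub>C (U ^^ n) y | c n. True}"
  have "U (c *\<^sub>C (U ^^ n) y) = c *\<^sub>C (U ^^ n) (U y)" for c n
    by (simp add: bounded_clinear_scaleC[OF U] funpow_swap1)
  then have img: "U ` ?O \<subseteq> {c *\<^sub>C (U ^^ n) (U y) | c n. True}"
    by blast
  have "closure ?O = UNIV" using y by (simp add: supercyclic_vector_def)
  then have "range U \<subseteq> closure (U ` ?O)"
    using image_closure_subset[OF bounded_clinear_continuous_on[OF U] closed_closure closure_subset, of ?O]
    by (simp only:)
  also have "\<dots> \<subseteq> closure {c *\<^sub>C (U ^^ n) (U y) | c n. True}"
    by (rule closure_mono[OF img])
  finally have "closure (range U) \<subseteq> closure {c *\<^sub>C (U ^^ n) (U y) | c n. True}"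
    by (simp add: closure_minimal)
  then show ?thesis
    using supercyclic_dense_range[OF assms] by (auto simp: supercyclic_vector_def)
qed

lemma supercyclic_vector_funpow:
  fixes U :: "'a::complex_hilbert \<Rightarrow> 'a"
  assumes U: "bounded_clinear U" and y: "supercyclic_vector U y" and dim: "\<And>y. cspan {y::'a} \<noteq> UNIV"
  shows "supercyclic_vector U ((U ^^ n) y)"
  by (induction n) (auto intro: y supercyclic_vector_image[OF U _ dim])

section \<open>Hyponormal operators are not supercyclic\<close>

text \<open>Write \<open>\<parallel>U x\<parallel>\<^sup>2\<close> as the inner product of \<open>U\<^sup>* U x\<close> with \<open>x\<close>, and compare \<open>U\<^sup>*\<close> with \<open>U\<close>
  at the vector \<open>U x\<close>.\<close>

lemma hyponormal_paranormal:
  assumes U: "bounded_clinear U" and "hyponormal U"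
  shows "(norm (U x))\<^sup>2 \<le> norm (U (U x)) * norm x"
proof -
  have "(norm (U x))\<^sup>2 = cmod (cinner (cadjoint U (U x)) x)"
    unfolding cinner_commute[of "cadjoint U (U x)" x] cinner_cadjoint[OF U, symmetric]
    by (simp add: cinner_self norm_power)
  also have "\<dots> \<le> norm (cadjoint U (U x)) * norm x" by (rule Cauchy_Schwarz)
  also have "\<dots> \<le> norm (U (U x)) * norm x"
    using assms by (intro mult_right_mono) (auto simp: hyponormal_iff)
  finally show ?thesis .
qed

text \<open>A supercyclic vector has the smallest growth quotient of all vectors, since the quotients
  increase along its orbit. The inequality is multiplied out because \<open>z\<close> may be zero.\<close>

lemma paranormal_supercyclic_lower:
  assumes U: "bounded_clinear U" and para: "\<And>x. (norm (U x))\<^sup>2 \<le> norm (U (U x)) * norm x"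
    and y: "supercyclic_vector U y"
  shows "norm (U y) * norm z \<le> norm (U z) * norm y"
proof (rule supercyclic_vector_closed[OF y, where P = "\<lambda>z. norm (U y) * norm z \<le> norm (U z) * norm y"])
  show "closed {z. norm (U y) * norm z \<le> norm (U z) * norm y}"
    by (intro closed_Collect_le continuous_intros bounded_clinear_continuous_on[OF U])
  have orbit: "norm (U y) * norm ((U ^^ n) y) \<le> norm (U ((U ^^ n) y)) * norm y" for n
  proof (induction n)
    case (Suc n)
    define x where "x = (U ^^ n) y"
    show ?case
    proof (cases "x = 0")
      case True
      then show ?thesis using bounded_clinear_scaleC[OF U, of 0 0] by (simp add: x_def)
    next
      case False
      have "norm x * (norm (U y) * norm (U x)) \<le> (norm (U x))\<^sup>2 * norm y"
        using mult_right_mono[OF Suc.IH, of "norm (U x)"]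
        by (simp add: x_def power2_eq_square mult_ac)
      also have "\<dots> \<le> norm x * (norm (U (U x)) * norm y)"
        using mult_right_mono[OF para[of x], of "norm y"] by (simp add: mult_ac)
      finally show ?thesis using False by (simp add: x_def)
    qed
  qed simp
  then show "norm (U y) * norm (c *\<^sub>C (U ^^ n) y) \<le> norm (U (c *\<^sub>C (U ^^ n) y)) * norm y" for c n
    using mult_left_mono[OF orbit, of "cmod c"]
    by (simp add: bounded_clinear_scaleC[OF U] norm_scaleC mult_ac)
qed

text \<open>For the upper estimate on the orbit, the minimality of the growth quotient is applied to the
  supercyclic vector \<open>U\<^sup>n y\<close> and compared with the quotient of \<open>y\<close>.\<close>

lemma paranormal_supercyclic_scaled_isometry:
  fixes U :: "'a::complex_hilbert \<Rightarrow> 'a"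
  assumes U: "bounded_clinear U" and para: "\<And>x. (norm (U x))\<^sup>2 \<le> norm (U (U x)) * norm x"
    and y: "supercyclic_vector U y" and dim: "\<And>y. cspan {y::'a} \<noteq> UNIV"
  shows "norm (U z) * norm y = norm (U y) * norm z"
proof (rule antisym)
  show "norm (U y) * norm z \<le> norm (U z) * norm y"
    by (rule paranormal_supercyclic_lower[OF U para y])
  show "norm (U z) * norm y \<le> norm (U y) * norm z"
  proof (rule supercyclic_vector_closed[OF y])
    show "closed {z. norm (U z) * norm y \<le> norm (U y) * norm z}"
      by (intro closed_Collect_le continuous_intros bounded_clinear_continuous_on[OF U])
    show "norm (U (c *\<^sub>C (U ^^ n) y)) * norm y \<le> norm (U y) * norm (c *\<^sub>C (U ^^ n) y)" for c n
      using mult_left_mono[OF paranormal_supercyclic_lower[OF U para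
          supercyclic_vector_funpow[OF U y dim, of n], of y], of "cmod c"]
      by (simp add: bounded_clinear_scaleC[OF U] norm_scaleC mult_ac)
  qed
qed

text \<open>On the orbit, \<open>U - \<mu>\<close> can be moved past \<open>U\<^sup>n\<close>, which scales all norms by \<open>r\<^sup>n\<close>.\<close>

lemma scaled_isometry_supercyclic_shift:
  assumes U: "bounded_clinear U" and iso: "\<And>z. norm (U z) = r * norm z"
    and y: "supercyclic_vector U y"
  shows "norm (U z - \<mu> *\<^sub>C z) * norm y = norm (U y - \<mu> *\<^sub>C y) * norm z"
proof (rule supercyclic_vector_closed[OF y])
  show "closed {z. norm (U z - \<mu> *\<^sub>C z) * norm y = norm (U y - \<mu> *\<^sub>C y) * norm z}"
    by (intro closed_Collect_eq continuous_intros bounded_clinear_continuous_on[OF U]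
        linear_continuous_on bounded_linear_scaleC)
  fix c n
  have pow: "norm ((U ^^ n) v) = r ^ n * norm v" for v
    by (induction n) (simp_all add: iso)
  have "U (c *\<^sub>C (U ^^ n) y) - \<mu> *\<^sub>C c *\<^sub>C (U ^^ n) y = c *\<^sub>C (U ^^ n) (U y - \<mu> *\<^sub>C y)"
    by (simp add: bounded_clinear_diff[OF bounded_clinear_funpow[OF U]]
        bounded_clinear_scaleC[OF bounded_clinear_funpow[OF U]] bounded_clinear_scaleC[OF U]
        cvec.scale_right_diff_distrib funpow_swap1 scaleC_scaleC mult.commute)
  then show "norm (U (c *\<^sub>C (U ^^ n) y) - \<mu> *\<^sub>C c *\<^sub>C (U ^^ n) y) * norm y
      = norm (U y - \<mu> *\<^sub>C y) * norm (c *\<^sub>C (U ^^ n) y)"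
    by (simp add: norm_scaleC pow)
qed

text \<open>This is complex polarisation: the symmetric part of the sesquilinear form \<open>\<langle>S x, w\<rangle>\<close> vanishes,
  and replacing \<open>w\<close> by \<open>\<i> w\<close> turns it into the antisymmetric part.\<close>

lemma zero_numerical_range:
  assumes S: "bounded_clinear S" and 0: "\<And>z. cinner (S z) z = 0"
  shows "S x = 0"
proof -
  have "cinner (S x) w + cinner (S w) x = 0" for w
    using 0[of "x + w"] by (simp add: bounded_clinear_add[OF S] cinner_add_left cinner_add_right 0 add.commute)
  from this[of "S x"] this[of "\<i> *\<^sub>C S x"] have "cinner (S x) (S x) = 0"
    by (simp add: bounded_clinear_scaleC[OF S] cinner_scaleC_left cinner_scaleC_right
        eq_neg_iff_add_eq_0 flip: right_diff_distrib)
  then show ?thesis by (simp add: cinner_self)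
qed

text \<open>In the squared norm of \<open>U z - \<mu> z\<close> the term linear in \<open>\<mu>\<close> is determined by \<open>\<langle>U z, z\<rangle>\<close>, while the
  assumption fixes the whole expression up to the factor \<open>\<parallel>z\<parallel>\<^sup>2\<close>. So \<open>\<langle>U z, z\<rangle>\<close> is a constant times
  \<open>\<parallel>z\<parallel>\<^sup>2\<close>.\<close>

lemma scalar_of_uniform_shifts:
  assumes U: "bounded_clinear U"
    and shift: "\<And>\<mu> z. norm (U z - \<mu> *\<^sub>C z) * norm y = norm (U y - \<mu> *\<^sub>C y) * norm z"
    and y: "norm y = 1"
  shows "U z = cinner (U y) y *\<^sub>C z"
proof -
  define c where "c = cinner (U y) y"
  have num: "cinner (U z) z = c * complex_of_real ((norm z)\<^sup>2)" for z
  proof -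
    have U0: "norm (U z) = norm (U y) * norm z" using shift[of z 0] y by simp
    have sq: "(norm (U z - \<mu> *\<^sub>C z))\<^sup>2 = (norm (U y - \<mu> *\<^sub>C y))\<^sup>2 * (norm z)\<^sup>2" for \<mu>
      using shift[of z \<mu>] y by (simp add: power_mult_distrib)
    have "Re (cnj \<mu> * cinner (U z) z) = Re (cnj \<mu> * c) * (norm z)\<^sup>2" for \<mu>
      using sq[of \<mu>] unfolding norm_diff_sq U0 norm_scaleC y power_mult_distrib cinner_scaleC_right
      by (simp add: c_def algebra_simps)
    \<comment> \<open>\<open>\<mu> = 1\<close> gives the real parts and \<open>\<mu> = \<i>\<close> the imaginary parts.\<close>
    from this[of 1] this[of \<i>] show ?thesis by (simp add: complex_eq_iff)
  qed
  have "bounded_clinear (\<lambda>z. U z - c *\<^sub>C z)"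
    by (rule bounded_clinear_sub[OF U bounded_clinear_scaleC_left])
  moreover have "cinner (U z - c *\<^sub>C z) z = 0" for z
    by (simp add: cinner_diff_left cinner_scaleC_left num cinner_self)
  ultimately show ?thesis using zero_numerical_range[of "\<lambda>z. U z - c *\<^sub>C z" z] by (simp add: c_def)
qed

text \<open>The dimension hypothesis is sharp: on a one-dimensional space every nonzero vector is
  supercyclic for every operator, and the zero space is spanned by \<open>0\<close>.\<close>

theorem hyponormal_not_supercyclic:
  fixes U :: "'a::complex_hilbert \<Rightarrow> 'a"
  assumes U: "bounded_clinear U" and hyp: "hyponormal U" and dim: "\<And>y. cspan {y::'a} \<noteq> UNIV"
  shows "\<not> supercyclic U"
proof
  assume "supercyclic U"
  then obtain y where y: "supercyclic_vector U y" by (auto simp: supercyclic_iff_vector)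
  have escape: False if "\<And>n. (U ^^ n) y \<in> cspan {y}"
  proof -
    have "z \<in> cspan {y}" for z
    proof (rule supercyclic_vector_closed[OF y, where P = "\<lambda>z. z \<in> cspan {y}"])
      show "closed {z. z \<in> cspan {y}}" by (simp add: closed_cspan_singleton)
      show "c *\<^sub>C (U ^^ n) y \<in> cspan {y}" for c n by (rule cvec.span_scale[OF that])
    qed
    then show False using dim[of y] by blast
  qed
  have "y \<noteq> 0"
  proof
    assume "y = 0"
    then have "(U ^^ n) y = 0" for n
      using bounded_clinear_scaleC[OF bounded_clinear_funpow[OF U], of n 0 0] by simp
    then show False by (intro escape) (simp add: cvec.span_zero)
  qed
  \<comment> \<open>At a unit vector the scalar that \<open>U\<close> will turn out to be is \<open>\<langle>U x, x\<rangle>\<close>.\<close>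
  define x where "x = complex_of_real (inverse (norm y)) *\<^sub>C y"
  have x1: "norm x = 1" using \<open>y \<noteq> 0\<close> by (simp add: x_def norm_scaleC norm_inverse)
  have iso: "norm (U z) = (norm (U y) / norm y) * norm z" for z
    using paranormal_supercyclic_scaled_isometry[OF U hyponormal_paranormal[OF U hyp] y dim, of z]
      \<open>y \<noteq> 0\<close> by (simp add: field_simps)
  have shift: "norm (U z - \<mu> *\<^sub>C z) * norm x = norm (U x - \<mu> *\<^sub>C x) * norm z" for \<mu> z
  proof -
    have "norm y * norm (U z - \<mu> *\<^sub>C z) = norm y * (norm (U x - \<mu> *\<^sub>C x) * norm z)"
      using scaled_isometry_supercyclic_shift[OF U iso y, of z \<mu>]
        scaled_isometry_supercyclic_shift[OF U iso y, of x \<mu>] x1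
      by (simp add: mult_ac)
    then show ?thesis using x1 \<open>y \<noteq> 0\<close> by simp
  qed
  have scalar: "U z = cinner (U x) x *\<^sub>C z" for z
    by (rule scalar_of_uniform_shifts[OF U shift x1])
  have "(U ^^ n) y \<in> cspan {y}" for n
    by (induction n) (simp_all add: cvec.span_base, subst scalar, rule cvec.span_scale)
  then show False by (rule escape)
qed

section \<open>The Hilbert space of Hilbert-Schmidt operators\<close>

lemma is_hilbert_schmidt_hs_apply: "is_hilbert_schmidt (hs_apply T)"
  using hs_apply by auto

lemma bounded_clinear_hs_apply: "bounded_clinear (hs_apply T)"
  by (rule hs_bounded[OF is_hilbert_schmidt_hs_apply])

lemma norm_hs_has_sum:
  "is_onb E \<Longrightarrow> ((\<lambda>e. (norm (hs_apply T e))\<^sup>2) has_sum (norm T)\<^sup>2) E"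
  unfolding norm_hilbert_schmidt.rep_eq
  by (rule hs_norm_has_sum[OF is_hilbert_schmidt_hs_apply])

lemma cinner_hs_summable:
  assumes E: "is_onb E"
  shows "(\<lambda>e. cinner (hs_apply S e) (hs_apply T e)) summable_on E"
proof (rule abs_summable_summable, rule summable_on_comparison_test)
  show "(\<lambda>e. (norm (hs_apply S e))\<^sup>2 + (norm (hs_apply T e))\<^sup>2) summable_on E"
    using norm_hs_has_sum[OF E] by (intro summable_on_add has_sum_imp_summable)
  fix e
  have "norm (hs_apply S e) * norm (hs_apply T e) \<le> (norm (hs_apply S e))\<^sup>2 + (norm (hs_apply T e))\<^sup>2"
    using sum_squares_bound[of "norm (hs_apply S e)" "norm (hs_apply T e)"]
      mult_nonneg_nonneg[OF norm_ge_zero[of "hs_apply S e"] norm_ge_zero[of "hs_apply T e"]]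
    by linarith
  then show "norm (cinner (hs_apply S e) (hs_apply T e))
      \<le> (norm (hs_apply S e))\<^sup>2 + (norm (hs_apply T e))\<^sup>2"
    using Cauchy_Schwarz order_trans by blast
qed simp

instantiation hilbert_schmidt :: (complex_hilbert) complex_hilbert
begin

definition cinner_hilbert_schmidt :: "'a hilbert_schmidt \<Rightarrow> 'a hilbert_schmidt \<Rightarrow> complex"
  where "cinner_hilbert_schmidt S T
    = (\<Sum>\<^sub>\<infinity>e\<in>(SOME E. is_onb E). cinner (hs_apply S e) (hs_apply T e))"

instance
proof
  fix S T R :: "'a hilbert_schmidt" and a :: complex
  define E where "E = (SOME E::'a set. is_onb E)"
  have E: "is_onb E" unfolding E_def using onb_exists by (rule someI_ex)
  note def = cinner_hilbert_schmidt_def[folded E_def]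
  show "cinner S T = cnj (cinner T S)"
    unfolding def infsum_cnj[symmetric] by (intro infsum_cong cinner_commute)
  show "cinner (S + T) R = cinner S R + cinner T R"
    unfolding def plus_hilbert_schmidt.rep_eq cinner_add_left
    by (intro infsum_add cinner_hs_summable E)
  show "cinner (a *\<^sub>C S) T = a * cinner S T"
    unfolding def scaleC_hilbert_schmidt.rep_eq cinner_scaleC_left
    by (rule infsum_cmult_right')
  show "cinner S S = complex_of_real ((norm S)\<^sup>2)"
    unfolding def cinner_self using norm_hs_has_sum[OF E]
    by (intro infsumI has_sum_of_real)
qed

end

lift_definition hs_adjoint :: "'a::complex_hilbert hilbert_schmidt \<Rightarrow> 'a hilbert_schmidt"
  is cadjoint by (rule hs_cadjoint)

lemma norm_hs_adjoint: "norm (hs_adjoint T) = norm T"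
  by transfer (rule hs_cadjoint)

lemma cadjoint_diff:
  assumes "bounded_clinear S" "bounded_clinear T"
  shows "cadjoint (\<lambda>x. S x - T x) = (\<lambda>x. cadjoint S x - cadjoint T x)"
  by (rule cadjoint_eqI) (simp add: cinner_diff_left cinner_diff_right cinner_cadjoint assms)

lemma cadjoint_scaleC:
  assumes "bounded_clinear T"
  shows "cadjoint (\<lambda>x. c *\<^sub>C T x) = (\<lambda>x. cnj c *\<^sub>C cadjoint T x)"
  by (rule cadjoint_eqI) (simp add: cinner_scaleC_left cinner_scaleC_right cinner_cadjoint assms)

lemma cadjoint_compose:
  assumes "bounded_clinear S" "bounded_clinear T"
  shows "cadjoint (\<lambda>x. S (T x)) = (\<lambda>x. cadjoint T (cadjoint S x))"
  by (rule cadjoint_eqI) (simp add: cinner_cadjoint assms)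

lemma hs_adjoint_diff: "hs_adjoint (S - T) = hs_adjoint S - hs_adjoint T"
  by transfer (simp add: cadjoint_diff hs_bounded)

lemma hs_adjoint_scaleC: "hs_adjoint (c *\<^sub>C T) = cnj c *\<^sub>C hs_adjoint T"
  by transfer (simp add: cadjoint_scaleC hs_bounded)

text \<open>The adjoint is a conjugate-linear isometry, so by polarisation it preserves the inner product up
  to conjugation. This replaces a computation with double sums and carries facts about left
  multiplication over to right multiplication.\<close>

lemma cinner_hs_adjoint: "cinner (hs_adjoint S) (hs_adjoint T) = cinner T S"
proof -
  have re: "Re (cinner (hs_adjoint S) (hs_adjoint T)) = Re (cinner S T)" for S T :: "'a hilbert_schmidt"
    using norm_diff_sq[of S T] norm_diff_sq[of "hs_adjoint S" "hs_adjoint T"]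
    by (simp add: norm_hs_adjoint flip: hs_adjoint_diff)
  from re[of S T] re[of "\<i> *\<^sub>C S" T] show ?thesis
    unfolding cinner_commute[of T S]
    by (simp add: complex_eq_iff hs_adjoint_scaleC cinner_scaleC_left del: cvec.scale_minus_left)
qed

text \<open>An unbounded factor need not preserve the Hilbert-Schmidt property; zero is a default value
  for it.\<close>

lift_definition hs_mult_left ::
    "('a::complex_hilbert \<Rightarrow> 'a) \<Rightarrow> 'a hilbert_schmidt \<Rightarrow> 'a hilbert_schmidt"
  is "\<lambda>A T. if bounded_clinear A then (\<lambda>x. A (T x)) else (\<lambda>x. 0)"
  by (simp add: hs_compose_left hs_zero)

lift_definition hs_mult_right ::
    "('a::complex_hilbert \<Rightarrow> 'a) \<Rightarrow> 'a hilbert_schmidt \<Rightarrow> 'a hilbert_schmidt"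
  is "\<lambda>B T. if bounded_clinear B then (\<lambda>x. T (B x)) else (\<lambda>x. 0)"
  by (simp add: hs_compose_right hs_zero)

lemma gen_derivation_eq:
  assumes "bounded_clinear A" "bounded_clinear B"
  shows "gen_derivation A B T = hs_mult_left A T - hs_mult_right B T"
  by (simp add: hs_apply_inject[symmetric] hs_apply_gen_derivation assms
      minus_hilbert_schmidt.rep_eq hs_mult_left.rep_eq hs_mult_right.rep_eq)

lemma hs_mult_left_right_commute:
  assumes "bounded_clinear A" "bounded_clinear B"
  shows "hs_mult_left A (hs_mult_right B T) = hs_mult_right B (hs_mult_left A T)"
  by (simp add: hs_apply_inject[symmetric] assms hs_mult_left.rep_eq hs_mult_right.rep_eq)

lemma hs_adjoint_mult_right:
  assumes "bounded_clinear B"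
  shows "hs_adjoint (hs_mult_right B T) = hs_mult_left (cadjoint B) (hs_adjoint T)"
  by (simp add: hs_apply_inject[symmetric] assms hs_mult_left.rep_eq hs_mult_right.rep_eq
      hs_adjoint.rep_eq bounded_clinear_cadjoint cadjoint_compose bounded_clinear_hs_apply)

lemma cinner_hs_mult_left:
  assumes "bounded_clinear A"
  shows "cinner (hs_mult_left A S) T = cinner S (hs_mult_left (cadjoint A) T)"
  by (simp add: cinner_hilbert_schmidt_def hs_mult_left.rep_eq assms cinner_cadjoint
      bounded_clinear_cadjoint)

lemma cinner_hs_mult_right:
  assumes B: "bounded_clinear B"
  shows "cinner (hs_mult_right B S) T = cinner S (hs_mult_right (cadjoint B) T)"
proof -
  have "cinner (hs_mult_right B S) T = cinner (hs_adjoint T) (hs_mult_left (cadjoint B) (hs_adjoint S))"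
    by (simp add: hs_adjoint_mult_right[OF B, symmetric] cinner_hs_adjoint)
  also have "\<dots> = cinner (hs_mult_left B (hs_adjoint T)) (hs_adjoint S)"
    by (rule cinner_hs_mult_left[OF B, symmetric])
  also have "\<dots> = cinner S (hs_mult_right (cadjoint B) T)"
    using hs_adjoint_mult_right[OF bounded_clinear_cadjoint[OF B], of T, symmetric]
    unfolding cadjoint_cadjoint[OF B] by (simp only: cinner_hs_adjoint)
  finally show ?thesis .
qed

text \<open>Evaluated at a basis vector \<open>e\<close>, the two operators are \<open>A (T e)\<close> and \<open>B (T e)\<close>, so the
  Hilbert-Schmidt norms compare term by term.\<close>

lemma norm_hs_mult_left_mono:
  assumes A: "bounded_clinear A" "bounded_clinear B" and le: "\<And>x. norm (A x) \<le> norm (B x)"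
  shows "norm (hs_mult_left A T) \<le> norm (hs_mult_left B T)"
proof -
  obtain E :: "'a set" where E: "is_onb E" using onb_exists by blast
  have "(norm (hs_mult_left A T))\<^sup>2 \<le> (norm (hs_mult_left B T))\<^sup>2"
    by (rule has_sum_mono[OF norm_hs_has_sum[OF E] norm_hs_has_sum[OF E]])
      (simp add: hs_mult_left.rep_eq A le power_mono)
  then show ?thesis by (rule power2_le_imp_le) simp
qed

section \<open>The generalised derivation\<close>

lemma bounded_clinear_hs_mult_left:
  assumes A: "bounded_clinear A"
  shows "bounded_clinear (hs_mult_left A)"
proof -
  obtain K where K: "K \<ge> 0" "\<And>x. norm (A x) \<le> K * norm x"
    using bounded_clinear_bound[OF A] by blast
  show ?thesis
  proof (rule bounded_clinearI[where K = K])
    show "hs_mult_left A (S + T) = hs_mult_left A S + hs_mult_left A T" for S T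
      by (simp add: hs_apply_inject[symmetric] A hs_mult_left.rep_eq plus_hilbert_schmidt.rep_eq
          bounded_clinear_add[OF A])
    show "hs_mult_left A (c *\<^sub>C T) = c *\<^sub>C hs_mult_left A T" for c T
      by (simp add: hs_apply_inject[symmetric] A hs_mult_left.rep_eq scaleC_hilbert_schmidt.rep_eq
          bounded_clinear_scaleC[OF A])
    fix T
    have "norm (hs_mult_left A T) \<le> norm (hs_mult_left (\<lambda>x. complex_of_real K *\<^sub>C x) T)"
      by (rule norm_hs_mult_left_mono[OF A bounded_clinear_scaleC_left])
        (simp add: norm_scaleC K)
    \<comment> \<open>The bound on \<open>A\<close> is a comparison with the scalar operator \<open>K\<close>.\<close>
    also have "hs_mult_left (\<lambda>x. complex_of_real K *\<^sub>C x) T = complex_of_real K *\<^sub>C T"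
      by (simp add: hs_apply_inject[symmetric] hs_mult_left.rep_eq scaleC_hilbert_schmidt.rep_eq
          bounded_clinear_scaleC_left)
    finally show "norm (hs_mult_left A T) \<le> K * norm T" using K(1) by (simp add: norm_scaleC)
  qed
qed

lemma norm_hs_mult_right:
  assumes B: "bounded_clinear B"
  shows "norm (hs_mult_right B T) = norm (hs_mult_left (cadjoint B) (hs_adjoint T))"
  by (metis B hs_adjoint_mult_right norm_hs_adjoint)

lemma bounded_clinear_hs_mult_right:
  assumes B: "bounded_clinear B"
  shows "bounded_clinear (hs_mult_right B)"
proof -
  obtain K where K: "K \<ge> 0" "\<And>T. norm (hs_mult_left (cadjoint B) T) \<le> K * norm T"
    using bounded_clinear_bound[OF bounded_clinear_hs_mult_left[OF bounded_clinear_cadjoint[OF B]]]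
    by blast
  show ?thesis
  proof (rule bounded_clinearI[where K = K])
    show "hs_mult_right B (S + T) = hs_mult_right B S + hs_mult_right B T" for S T
      by (simp add: hs_apply_inject[symmetric] B hs_mult_right.rep_eq plus_hilbert_schmidt.rep_eq)
    show "hs_mult_right B (c *\<^sub>C T) = c *\<^sub>C hs_mult_right B T" for c T
      by (simp add: hs_apply_inject[symmetric] B hs_mult_right.rep_eq scaleC_hilbert_schmidt.rep_eq)
    show "norm (hs_mult_right B T) \<le> K * norm T" for T
      using K(2)[of "hs_adjoint T"] by (simp add: norm_hs_mult_right[OF B] norm_hs_adjoint)
  qed
qed

lemma bounded_clinear_gen_derivation:
  assumes A: "bounded_clinear A" and B: "bounded_clinear B"
  shows "bounded_clinear (gen_derivation A B)"
proof -
  have eq: "gen_derivation A B = (\<lambda>T. hs_mult_left A T - hs_mult_right B T)"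
    using gen_derivation_eq[OF A B] by blast
  show ?thesis
    unfolding eq
    by (rule bounded_clinear_sub[OF bounded_clinear_hs_mult_left[OF A] bounded_clinear_hs_mult_right[OF B]])
qed

lemma cadjoint_gen_derivation:
  assumes A: "bounded_clinear A" and B: "bounded_clinear B"
  shows "cadjoint (gen_derivation A B) = gen_derivation (cadjoint A) (cadjoint B)"
  by (rule cadjoint_eqI)
    (simp add: gen_derivation_eq A B bounded_clinear_cadjoint cinner_diff_left cinner_diff_right
      cinner_hs_mult_left cinner_hs_mult_right)

text \<open>Both squared norms are expanded. The mixed terms are complex conjugates of each other because
  left and right multiplications commute; the other two terms are compared separately.\<close>

lemma hyponormal_gen_derivation:
  assumes A: "bounded_clinear A" and B: "bounded_clinear B"
    and hA: "hyponormal A" and hB: "hyponormal (cadjoint B)"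
  shows "hyponormal (gen_derivation A B)"
  unfolding hyponormal_iff[OF bounded_clinear_gen_derivation[OF A B]]
proof
  fix T
  note A' = bounded_clinear_cadjoint[OF A] and B' = bounded_clinear_cadjoint[OF B]
  have left: "norm (hs_mult_left (cadjoint A) T) \<le> norm (hs_mult_left A T)"
    using hA hyponormal_iff[OF A] by (intro norm_hs_mult_left_mono A A') auto
  have right: "norm (hs_mult_right (cadjoint B) T) \<le> norm (hs_mult_right B T)"
    unfolding norm_hs_mult_right[OF B] norm_hs_mult_right[OF B'] cadjoint_cadjoint[OF B]
    using hB hyponormal_iff[OF B'] by (intro norm_hs_mult_left_mono B B') (auto simp: cadjoint_cadjoint[OF B])
  have "cinner (hs_mult_left A T) (hs_mult_right B T)
      = cinner (hs_mult_right (cadjoint B) T) (hs_mult_left (cadjoint A) T)"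
    using cinner_hs_mult_right[OF B', of "hs_mult_left A T" T]
      cinner_hs_mult_left[OF A, of "hs_mult_right (cadjoint B) T" T]
    by (simp add: hs_mult_left_right_commute A B' cadjoint_cadjoint[OF B])
  then have cross: "Re (cinner (hs_mult_left A T) (hs_mult_right B T))
      = Re (cinner (hs_mult_left (cadjoint A) T) (hs_mult_right (cadjoint B) T))"
    using cinner_commute[of "hs_mult_left (cadjoint A) T" "hs_mult_right (cadjoint B) T"] by simp
  have "(norm (cadjoint (gen_derivation A B) T))\<^sup>2 \<le> (norm (gen_derivation A B T))\<^sup>2"
    unfolding cadjoint_gen_derivation[OF A B] gen_derivation_eq[OF A B] gen_derivation_eq[OF A' B']
      norm_diff_sq cross
    using power_mono[OF left norm_ge_zero, of 2] power_mono[OF right norm_ge_zero, of 2] by linarith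
  then show "norm (cadjoint (gen_derivation A B) T) \<le> norm (gen_derivation A B T)"
    by (rule power2_le_imp_le) simp
qed

lemma hs_rank_one: "is_hilbert_schmidt (\<lambda>x. cinner x u *\<^sub>C v)"
proof -
  obtain E :: "'a set" where E: "is_onb E" using onb_exists by blast
  have "bounded_clinear (\<lambda>x. cinner x u *\<^sub>C v)"
  proof (rule bounded_clinearI[where K = "norm u * norm v"])
    show "norm (cinner x u *\<^sub>C v) \<le> norm u * norm v * norm x" for x
      using mult_right_mono[OF Cauchy_Schwarz[of x u], of "norm v"] by (simp add: norm_scaleC mult_ac)
  qed (simp_all add: cinner_add_left cinner_scaleC_left scaleC_add_left scaleC_scaleC)
  moreover have "(norm (cinner e u *\<^sub>C v))\<^sup>2 = (cmod (cinner u e))\<^sup>2 * (norm v)\<^sup>2" for e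
    using cinner_commute[of e u] by (simp add: norm_scaleC power_mult_distrib)
  then have "(\<lambda>e. (norm (cinner e u *\<^sub>C v))\<^sup>2) summable_on E"
    using has_sum_imp_summable[OF parseval[OF E, of u]] by (simp add: summable_on_cmult_left)
  ultimately show ?thesis using E by (auto simp: is_hilbert_schmidt_def)
qed

text \<open>For \<open>u \<noteq> 0\<close> and every \<open>v\<close> a rank-one operator maps \<open>u\<close> to \<open>v\<close> up to a nonzero factor. If all
  these were multiples of \<open>S\<close>, then every \<open>v\<close> would be a multiple of \<open>S u\<close>.\<close>

lemma cspan_singleton_hilbert_schmidt:
  fixes S :: "'a::complex_hilbert hilbert_schmidt"
  assumes dim: "\<And>u. cspan {u::'a} \<noteq> UNIV"
  shows "cspan {S} \<noteq> UNIV"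
proof
  assume S: "cspan {S} = UNIV"
  obtain u :: 'a where u: "u \<noteq> 0" using dim[of 0] by auto
  have "v \<in> cspan {hs_apply S u}" for v
  proof -
    have "Abs_hilbert_schmidt (\<lambda>x. cinner x u *\<^sub>C v) \<in> cspan {S}" by (simp add: S)
    then obtain c where "Abs_hilbert_schmidt (\<lambda>x. cinner x u *\<^sub>C v) = c *\<^sub>C S"
      by (auto simp: cvec.span_singleton)
    then have "cinner u u *\<^sub>C v = c *\<^sub>C hs_apply S u"
      by (metis Abs_hilbert_schmidt_inverse hs_rank_one mem_Collect_eq scaleC_hilbert_schmidt.rep_eq)
    then have "cinner u u *\<^sub>C v \<in> cspan {hs_apply S u}"
      by (simp add: cvec.span_base cvec.span_scale)
    then have "inverse (cinner u u) *\<^sub>C cinner u u *\<^sub>C v \<in> cspan {hs_apply S u}"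
      by (rule cvec.span_scale)
    then show ?thesis using u by (simp add: scaleC_scaleC cinner_self scaleC_one)
  qed
  then show False using dim by blast
qed

theorem theorem4p1:
  fixes A B :: "'a::complex_hilbert \<Rightarrow> 'a"
  assumes "\<not> (\<exists>F::'a set. finite F \<and> cspan F = UNIV)"
    and "bounded_clinear A" and "bounded_clinear B"
    and "hyponormal A" and "hyponormal (cadjoint B)"
  shows "\<not> supercyclic (gen_derivation A B)"
proof (rule hyponormal_not_supercyclic)
  show "bounded_clinear (gen_derivation A B)"
    by (rule bounded_clinear_gen_derivation[OF assms(2,3)])
  show "hyponormal (gen_derivation A B)"
    by (rule hyponormal_gen_derivation[OF assms(2-5)])
  have "cspan {u::'a} \<noteq> UNIV" for u using assms(1) by blast
  then show "cspan {S :: 'a hilbert_schmidt} \<noteq> UNIV" for S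
    by (rule cspan_singleton_hilbert_schmidt)
qed

end
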